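(* Let $X$ and $Y$ be UDBG spaces and let $f\colon X\to Y$ be a quasi-isometry. Then the following are equivalent: (1) The map $f\colon X\to Y$ is uniformly close to a bilipschitz equivalence. (2) For all $k\in\mathbb{N}$, the map $H^{\mathrm{uf}}_k(f;\mathbb{Z})\colon H^{\mathrm{uf}}_k(X;\mathbb{Z})\to H^{\mathrm{uf}}_k(Y;\mathbb{Z})$ is an isometric isomorphism with respect to the $\ell^\infty$-semi-norm. (3) The map $H^{\mathrm{uf}}_0(f;\mathbb{Z})\colon H^{\mathrm{uf}}_0(X;\mathbb{Z})\to H^{\mathrm{uf}}_0(Y;\mathbb{Z})$ is an isometric isomorphism with respect to the $\ell^\infty$-semi-norm.
   Context: $\mathbb{N}=\{0,1,2,\dots\}$. A metric space $X$ is a UDBG space if (i) there is $\varepsilon>0$ such that for all $x,y\in X$: $d(x,y)<\varepsilon$ if and only if $x=y$; and (ii) for every $r>0$ there is $K>0$ with $|B_r(x)|<K$ for all $x\in X$. Maps between UDBG spaces: $f\colon X\to Y$ is a quasi-isometric embedding if there are $C,D>0$ with $\frac1C d_X(x,x')-D\le d_Y(f(x),f(x'))\le C d_X(x,x')+D$ for all $x,x'\in X$. Maps $f,f'\colon X\to Y$ are uniformly close if $\sup_{x\in X}d_Y(f(x),f'(x))<\infty$. A quasi-isometry is a quasi-isometric embedding $f$ for which there is a quasi-isometric embedding $g\colon Y\to X$ with $f\circ g$ uniformly close to $\mathrm{id}_Y$ and $g\circ f$ uniformly close to $\mathrm{id}_X$. A bilipschitz embedding is a map $f$ for which there is $C>0$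 with $\frac1C d_X(x,x')\le d_Y(f(x),f(x'))\le C d_X(x,x')$ for all $x,x'$; a bilipschitz equivalence is a bilipschitz embedding having a two-sided inverse that is a bilipschitz embedding. Uniformly finite homology: let $R=\mathbb{Z}$ with the standard absolute value $|\cdot|$. For a UDBG space $X$ and $n\in\mathbb{N}$, $C^{\mathrm{uf}}_n(X;R)$ is the $R$-module of functions $X^{n+1}\to R$, written as formal sums $c=\sum_{x\in X^{n+1}}c_x\cdot x$, such that $\sup_x|c_x|<\infty$ and there is a constant $\rho>0$ (depending on $c$) with $c_x=0$ whenever $x=(x_0,\dots,x_n)$ satisfies $\sup_{i,j}d(x_i,x_j)>\rho$. The boundary operator $\partial_n\colon C^{\mathrm{uf}}_n(X;R)\to C^{\mathrm{uf}}_{n-1}(X;R)$ is the extension to such (possibly infinite) sums of $(x_0,\dots,x_n)\mapsto\sum_{j=0}^n(-1)^j(x_0,\dots,\widehat{x_j},\dots,x_n)$ (and every $0$-chain is a cycle). $H^{\mathrm{uf}}_*(X;R)$ is the homology of this chain complex. A quasi-isometric embedding $f\colon X\to Y$ induces the chain map $\sum_x c_x\cdot x\mapsto\sum_x c_x\cdot(f(x_0),\dots,f(x_n))$ and hence maps $H^{\mathrm{uf}}_n(f;R)\colon H^{\mathrm{uf}}_n(X;R)\to H^{\mathrm{uf}}_n(Y;R)$. The $\ell^\infty$-norm on chains is $\|\sum_x c_x\cdot x\|_\infty=\sup_x|c_x|$, and the $\ell^\infty$-semi-norm of $\alpha\in H^{\mathrm{uf}}_n(X;R)$ is $\|\alpha\|_\infty=\inf\{\|c\|_\infty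 : c\in C^{\mathrm{uf}}_n(X;R),\ \partial c=0,\ [c]=\alpha\}$. An isometric isomorphism is an $R$-linear isomorphism preserving the semi-norms. *)

theory Defs
  imports "HOL-Analysis.Elementary_Metric_Spaces" "HOL-Algebra.Coset"
begin

text \<open>A metric space is a set \<open>X :: 'a::metric_space set\<close> with the restricted metric (the empty
  space is allowed). Maps \<open>X \<rightarrow> Y\<close> are functions whose values outside \<open>X\<close> are irrelevant.\<close>

definition UDBG :: "'a::metric_space set \<Rightarrow> bool" where
  "UDBG X \<longleftrightarrow>
     (\<exists>\<epsilon>>0. \<forall>x\<in>X. \<forall>y\<in>X. dist x y < \<epsilon> \<longleftrightarrow> x = y) \<and>
     (\<forall>r>0. \<exists>K>0. \<forall>x\<in>X. finite (X \<inter> ball x r) \<and> card (X \<inter> ball x r) < K)"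

definition qi_embedding ::
    "'a::metric_space set \<Rightarrow> 'b::metric_space set \<Rightarrow> ('a \<Rightarrow> 'b) \<Rightarrow> bool" where
  "qi_embedding X Y f \<longleftrightarrow> f \<in> X \<rightarrow> Y \<and>
     (\<exists>C>0. \<exists>D>0. \<forall>x\<in>X. \<forall>x'\<in>X.
        1 / C * dist x x' - D \<le> dist (f x) (f x') \<and> dist (f x) (f x') \<le> C * dist x x' + D)"

definition uniformly_close :: "'a set \<Rightarrow> ('a \<Rightarrow> 'b::metric_space) \<Rightarrow> ('a \<Rightarrow> 'b) \<Rightarrow> bool" where
  "uniformly_close X f f' \<longleftrightarrow> bdd_above ((\<lambda>x. dist (f x) (f' x)) ` X)"

definition quasi_isometry ::
    "'a::metric_space set \<Rightarrow> 'b::metric_space set \<Rightarrow> ('a \<Rightarrow> 'b) \<Rightarrow> bool" where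
  "quasi_isometry X Y f \<longleftrightarrow> qi_embedding X Y f \<and>
     (\<exists>g. qi_embedding Y X g \<and> uniformly_close Y (f \<circ> g) id \<and> uniformly_close X (g \<circ> f) id)"

definition bilipschitz_embedding ::
    "'a::metric_space set \<Rightarrow> 'b::metric_space set \<Rightarrow> ('a \<Rightarrow> 'b) \<Rightarrow> bool" where
  "bilipschitz_embedding X Y f \<longleftrightarrow> f \<in> X \<rightarrow> Y \<and>
     (\<exists>C>0. \<forall>x\<in>X. \<forall>x'\<in>X.
        1 / C * dist x x' \<le> dist (f x) (f x') \<and> dist (f x) (f x') \<le> C * dist x x')"

definition bilipschitz_equivalence ::
    "'a::metric_space set \<Rightarrow> 'b::metric_space set \<Rightarrow> ('a \<Rightarrow> 'b) \<Rightarrow> bool" where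
  "bilipschitz_equivalence X Y f \<longleftrightarrow> bilipschitz_embedding X Y f \<and>
     (\<exists>g. bilipschitz_embedding Y X g \<and> (\<forall>x\<in>X. g (f x) = x) \<and> (\<forall>y\<in>Y. f (g y) = y))"

text \<open>Uniformly finite chains with integer coefficients. A tuple in \<open>X\<^sup>n\<^sup>+\<^sup>1\<close> is a list of length
  \<open>n + 1\<close> with entries in \<open>X\<close>; a function \<open>X\<^sup>n\<^sup>+\<^sup>1 \<rightarrow> \<int>\<close> is extended by \<open>0\<close> to all lists.\<close>

definition uf_chains :: "'a::metric_space set \<Rightarrow> nat \<Rightarrow> ('a list \<Rightarrow> int) set" where
  "uf_chains X n = {c.
     (\<forall>xs. \<not> (length xs = Suc n \<and> set xs \<subseteq> X) \<longrightarrow> c xs = 0) \<and>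
     bdd_above (range (\<lambda>xs. \<bar>c xs\<bar>)) \<and>
     (\<exists>\<rho>>0. \<forall>xs. (\<exists>x\<in>set xs. \<exists>y\<in>set xs. dist x y > \<rho>) \<longrightarrow> c xs = 0)}"

text \<open>The extension \<open>\<Sum> c\<^sub>x \<cdot> x \<mapsto> \<Sum> c\<^sub>x \<cdot> \<phi>(x)\<close> of a map \<open>\<phi>\<close> of tuples to formal sums. The index set
  below has to be finite for the sum to be meaningful; for uniformly finite chains on UDBG
  spaces this is the case for the face maps in positive degree and for the maps induced by
  quasi-isometric embeddings.\<close>

definition formal_extension :: "('a list \<Rightarrow> 'b list) \<Rightarrow> ('a list \<Rightarrow> int) \<Rightarrow> 'b list \<Rightarrow> int" where
  "formal_extension \<phi> c ys = (\<Sum>xs | c xs \<noteq> 0 \<and> \<phi> xs = ys. c xs)"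

definition face :: "nat \<Rightarrow> 'a list \<Rightarrow> 'a list" where
  "face j xs = take j xs @ drop (Suc j) xs"

definition uf_boundary :: "nat \<Rightarrow> ('a list \<Rightarrow> int) \<Rightarrow> 'a list \<Rightarrow> int" where
  "uf_boundary n c =
     (if n = 0 then (\<lambda>_. 0) else (\<lambda>ys. \<Sum>j\<le>n. (-1) ^ j * formal_extension (face j) c ys))"

definition uf_cycles :: "'a::metric_space set \<Rightarrow> nat \<Rightarrow> ('a list \<Rightarrow> int) set" where
  "uf_cycles X n = {c \<in> uf_chains X n. uf_boundary n c = (\<lambda>_. 0)}"

definition uf_boundaries :: "'a::metric_space set \<Rightarrow> nat \<Rightarrow> ('a list \<Rightarrow> int) set" where
  "uf_boundaries X n = uf_boundary (Suc n) ` uf_chains X (Suc n)"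

definition uf_cycle_group :: "'a::metric_space set \<Rightarrow> nat \<Rightarrow> ('a list \<Rightarrow> int) monoid" where
  "uf_cycle_group X n =
     \<lparr>carrier = uf_cycles X n, mult = (\<lambda>c c' xs. c xs + c' xs), one = (\<lambda>_. 0)\<rparr>"

definition uf_homology :: "'a::metric_space set \<Rightarrow> nat \<Rightarrow> ('a list \<Rightarrow> int) set monoid" where
  "uf_homology X n = uf_cycle_group X n Mod uf_boundaries X n"

text \<open>\<open>[c] \<mapsto> [f\<^sub>*c]\<close>; all representatives \<open>c\<close> of \<open>\<alpha>\<close> give the same class.\<close>

definition uf_homology_map ::
    "'b::metric_space set \<Rightarrow> nat \<Rightarrow> ('a \<Rightarrow> 'b) \<Rightarrow> ('a list \<Rightarrow> int) set \<Rightarrow> ('b list \<Rightarrow> int) set" where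
  "uf_homology_map Y n f \<alpha> =
     the_elem ((\<lambda>c. uf_boundaries Y n #>\<^bsub>uf_cycle_group Y n\<^esub> formal_extension (map f) c) ` \<alpha>)"

definition uf_norm :: "('a list \<Rightarrow> int) \<Rightarrow> real" where
  "uf_norm c = (SUP xs. real_of_int \<bar>c xs\<bar>)"

text \<open>The elements of a class \<open>\<alpha>\<close>, as a coset, are exactly the cycles representing it.\<close>

definition uf_seminorm :: "('a list \<Rightarrow> int) set \<Rightarrow> real" where
  "uf_seminorm \<alpha> = (INF c\<in>\<alpha>. uf_norm c)"

text \<open>\<open>\<int>\<close>-linear maps are the same as homomorphisms of the underlying abelian groups.\<close>

definition uf_isometric_iso ::
    "'a::metric_space set \<Rightarrow> 'b::metric_space set \<Rightarrow> nat \<Rightarrow> ('a \<Rightarrow> 'b) \<Rightarrow> bool" where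
  "uf_isometric_iso X Y n f \<longleftrightarrow>
     uf_homology_map Y n f \<in> iso (uf_homology X n) (uf_homology Y n) \<and>
     (\<forall>\<alpha>\<in>carrier (uf_homology X n). uf_seminorm (uf_homology_map Y n f \<alpha>) = uf_seminorm \<alpha>)"

end

theory Submission
  imports Defs
begin

text \<open>A bilipschitz equivalence \<open>f'\<close> merely relabels tuples, so on chains it is a bijection that preserves
the supremum norm and commutes with the boundary; hence it is an isometric isomorphism in every
degree. A map \<open>f\<close> uniformly close to \<open>f'\<close> is chain homotopic to it by the usual prism operator, whose
simplices have bounded diameter exactly because the two maps are close; so \<open>f\<close> and \<open>f'\<close> agree on
homology. All operators on chains (faces, induced maps, prisms) are extensions of maps of tuples that
are coarse embeddings, and this class is closed under composition: that makes the extensions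
functorial (\<open>formal_extension_comp\<close>), and every chain identity then reduces to one about lists.

The substance is that an isometric isomorphism in degree \<open>0\<close> forces \<open>f\<close> to be close to a bijection.
The fundamental class \<open>[X]\<close>, the sum of all points, has seminorm at most \<open>1\<close>. Coefficients are integers, so
a class of seminorm at most \<open>1\<close> has a representative with values in \<open>{-1, 0, 1}\<close>. Applied to the image of \<open>[X]\<close>
this gives \<open>f\<^sub>*[X] = [d]\<close> with \<open>d \<le> 1\<close>; applied to the preimage of \<open>[Y]\<close> it gives \<open>[Y] = f\<^sub>*[c]\<close> with
\<open>c \<le> 1\<close>. A boundary is a flow of bounded strength along edges of bounded length, so its sum over a finite
set \<open>S\<close> is at most a constant times the number of points just outside \<open>S\<close> (\<open>boundary_flow_bound\<close>). Hence the
numbers of points of \<open>f\<^sup>-\<^sup>1 S\<close> and of \<open>S\<close> differ by at most \<open>D\<close> times the size of the outer boundary of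
\<open>S\<close> (\<open>isometric_iso_imp_flow\<close>).

The combinatorial core \<open>expansion_matching\<close> turns such an estimate into an injection that moves points
a bounded distance, by Hall's theorem for infinite families. It needs two surjections onto a common set, so
\<open>Y\<close> is first retracted onto the coarsely dense image of \<open>f\<close>. If some finite \<open>S\<close> had more preimages
than there are places over its \<open>n\<close>-fold enlargement \<open>S\<^sub>n\<close>, then the estimate for every \<open>S\<^sub>k\<close>, together with the
fact that every point has a preimage under both maps, would make \<open>D (|S\<^sub>k\<^sub>+\<^sub>1| - |S\<^sub>k|)\<close> larger than
\<open>|S\<^sub>n| - |S|\<close> for each \<open>k < n\<close>; the sum over \<open>k\<close> telescopes, which is absurd once \<open>n > D\<close>. The estimate is symmetric, so there are injections
both ways, and the Cantor--Bernstein argument merges them into one bijection close to \<open>f\<close>. In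
uniformly discrete spaces additive errors can be absorbed into multiplicative ones, so this bijection
is a bilipschitz equivalence.\<close>

section \<open>Matchings in infinite families\<close>

text \<open>Hall's theorem for arbitrarily many finite sets, by Rado's argument: among the subrelations of membership that
still satisfy Hall's condition, a minimal one exists by Zorn's lemma and must be a function. For if an
index were related to two elements and neither could be discarded, each would come with a critical finite set of
indices; counting the union and the intersection of their neighbourhoods contradicts Hall's
condition. Minimality is phrased as maximality of the discarded part \<open>M\<close>.\<close>
theorem hall_marriage:
  fixes A :: "'i \<Rightarrow> 'c set"
  assumes fin: "\<And>i. i \<in> I \<Longrightarrow> finite (A i)"
    and hall: "\<And>J. J \<subseteq> I \<Longrightarrow> finite J \<Longrightarrow> card J \<le> card (\<Union>i\<in>J. A i)"
  shows "\<exists>\<phi>. inj_on \<phi> I \<and> (\<forall>i\<in>I. \<phi> i \<in> A i)"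
proof -
  define hallian where "hallian E \<longleftrightarrow> (\<forall>J. J \<subseteq> I \<longrightarrow> finite J \<longrightarrow> card J \<le> card (E `` J))"
    for E :: "('i \<times> 'c) set"
  define \<D> where "\<D> = {M. M \<subseteq> Sigma I A \<and> hallian (Sigma I A - M)}"
  have "Sigma I A `` J = (\<Union>i\<in>J. A i)" if "J \<subseteq> I" for J
    using that by auto
  then have "hallian (Sigma I A)"
    unfolding hallian_def using hall by simp
  then have "\<D> \<noteq> {}"
    unfolding \<D>_def by (metis (mono_tags, lifting) Diff_empty empty_Collect_eq empty_subsetI)
  moreover have "\<Union>\<C> \<in> \<D>" if "\<C> \<noteq> {}" and chain: "subset.chain \<D> \<C>" for \<C>
  proof -
    have sub: "\<C> \<subseteq> \<D>"
      using chain by (simp add: subset.chain_def)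
    have "card J \<le> card ((Sigma I A - \<Union>\<C>) `` J)" if J: "J \<subseteq> I" "finite J" for J
    proof -
      \<comment> \<open>Over finitely many indices only finitely many pairs can be discarded, so a single member
        of the chain already discards all of them.\<close>
      have "finite (Sigma J A)"
        using J fin by (intro finite_SigmaI) auto
      then have "finite (Sigma J A \<inter> \<Union>\<C>)" by blast
      then obtain M where M: "M \<in> \<C>" "Sigma J A \<inter> \<Union>\<C> \<subseteq> M"
        using finite_subset_Union_chain[OF _ _ \<open>\<C> \<noteq> {}\<close> chain] by (metis inf_le2)
      have "(Sigma I A - \<Union>\<C>) `` J = (Sigma I A - M) `` J"
        using J M by blast
      moreover have "hallian (Sigma I A - M)"
        using M(1) sub by (auto simp: \<D>_def)
      ultimately show ?thesis
        using J by (simp add: hallian_def)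
    qed
    moreover have "\<Union>\<C> \<subseteq> Sigma I A"
      using sub by (auto simp: \<D>_def)
    ultimately show ?thesis by (simp add: \<D>_def hallian_def)
  qed
  ultimately obtain M where M: "M \<in> \<D>" and maximal: "\<And>M'. M' \<in> \<D> \<Longrightarrow> M \<subseteq> M' \<Longrightarrow> M' = M"
    using subset_Zorn_nonempty[of \<D>] by metis
  define E where "E = Sigma I A - M"
  have hE: "card J \<le> card (E `` J)" if "J \<subseteq> I" "finite J" for J
    using M that by (simp add: \<D>_def hallian_def E_def)
  have finE: "finite (E `` J)" if "finite J" for J
  proof (rule finite_subset)
    show "E `` J \<subseteq> (\<Union>i\<in>J \<inter> I. A i)" by (auto simp: E_def)
    show "finite (\<Union>i\<in>J \<inter> I. A i)" using that fin by auto
  qed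
  have critical: "\<exists>J. J \<subseteq> I \<and> finite J \<and> i \<notin> J \<and> card (E `` J \<union> (E `` {i} - {x})) \<le> card J"
    if ix: "(i, x) \<in> E" for i x
  proof -
    have "i \<in> I" "insert (i, x) M \<noteq> M" using ix by (auto simp: E_def)
    then have "insert (i, x) M \<notin> \<D>" using maximal by blast
    moreover have "Sigma I A - insert (i, x) M = E - {(i, x)}" by (auto simp: E_def)
    moreover have "insert (i, x) M \<subseteq> Sigma I A" using M ix by (auto simp: \<D>_def E_def)
    ultimately obtain J where J: "J \<subseteq> I" "finite J" "card ((E - {(i, x)}) `` J) < card J"
      by (auto simp: \<D>_def hallian_def not_le)
    have "i \<in> J"
    proof (rule ccontr)
      assume "i \<notin> J"
      then have "(E - {(i, x)}) `` J = E `` J" by blast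
      then show False using J hE[of J] by simp
    qed
    then have "(E - {(i, x)}) `` J = E `` (J - {i}) \<union> (E `` {i} - {x})" by blast
    moreover have "card J = Suc (card (J - {i}))"
      using \<open>i \<in> J\<close> J by (metis card_Suc_Diff1)
    ultimately show ?thesis
      using J by (intro exI[of _ "J - {i}"]) auto
  qed
  have unique: "x = y" if ix: "(i, x) \<in> E" and iy: "(i, y) \<in> E" for i x y
  proof (rule ccontr)
    assume "x \<noteq> y"
    obtain J where J: "J \<subseteq> I" "finite J" "i \<notin> J" "card (E `` J \<union> (E `` {i} - {x})) \<le> card J"
      using critical[OF ix] by blast
    obtain K where K: "K \<subseteq> I" "finite K" "i \<notin> K" "card (E `` K \<union> (E `` {i} - {y})) \<le> card K"
      using critical[OF iy] by blast
    let ?U = "E `` J \<union> (E `` {i} - {x})" and ?V = "E `` K \<union> (E `` {i} - {y})"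
    have fin2: "finite ?U" "finite ?V"
      using finE J(2) K(2) by auto
    have "i \<in> I" using ix by (auto simp: E_def)
    have "card (insert i (J \<union> K)) \<le> card (E `` insert i (J \<union> K))"
      using J K \<open>i \<in> I\<close> by (intro hE) auto
    also have "\<dots> \<le> card (?U \<union> ?V)"
      using fin2 \<open>x \<noteq> y\<close> by (intro card_mono) blast+
    finally have 1: "Suc (card (J \<union> K)) \<le> card (?U \<union> ?V)"
      using J K by simp
    have "card (J \<inter> K) \<le> card (E `` (J \<inter> K))"
      using J K by (intro hE) auto
    also have "\<dots> \<le> card (?U \<inter> ?V)"
      using fin2 by (intro card_mono) blast+
    finally have 2: "card (J \<inter> K) \<le> card (?U \<inter> ?V)" .
    show False
      using 1 2 J(4) K(4) card_Un_Int[OF fin2] card_Un_Int[OF J(2) K(2)] by linarith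
  qed
  have "\<exists>x. (i, x) \<in> E" if "i \<in> I" for i
  proof -
    have "E `` {i} \<noteq> {}" using hE[of "{i}"] that by auto
    then show ?thesis by blast
  qed
  then obtain \<phi> where \<phi>: "\<And>i. i \<in> I \<Longrightarrow> (i, \<phi> i) \<in> E"
    by metis
  have "inj_on \<phi> I"
  proof (rule inj_onI, rule ccontr)
    fix i j assume ij: "i \<in> I" "j \<in> I" "\<phi> i = \<phi> j" "i \<noteq> j"
    then have "E `` {i, j} = {\<phi> i}"
      using \<phi>[of i] \<phi>[of j] unique by auto
    then show False using hE[of "{i, j}"] ij by simp
  qed
  moreover have "\<forall>i\<in>I. \<phi> i \<in> A i"
    using \<phi> by (auto simp: E_def)
  ultimately show ?thesis by blast
qed

text \<open>The Cantor--Bernstein bijection uses, at each point, either \<open>\<phi>\<close> or the inverse of \<open>\<psi>\<close>. It therefore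
inherits any relation that both injections respect, such as moving points by a bounded amount.\<close>
lemma Schroeder_Bernstein_relation:
  assumes "inj_on \<phi> P" "\<phi> ` P \<subseteq> Q" "\<And>x. x \<in> P \<Longrightarrow> R x (\<phi> x)"
    and "inj_on \<psi> Q" "\<psi> ` Q \<subseteq> P" "\<And>y. y \<in> Q \<Longrightarrow> R (\<psi> y) y"
  shows "\<exists>h. bij_betw h P Q \<and> (\<forall>x\<in>P. R x (h x))"
proof -
  define \<Phi> where "\<Phi> B = P - \<psi> ` (Q - \<phi> ` B)" for B
  have "mono \<Phi>"
    unfolding mono_def \<Phi>_def by (intro allI impI Diff_mono image_mono) simp_all
  define B where "B = lfp \<Phi>"
  have B: "B = P - \<psi> ` (Q - \<phi> ` B)"
    using lfp_unfold[OF \<open>mono \<Phi>\<close>] by (simp add: B_def \<Phi>_def)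
  define h where "h x = (if x \<in> B then \<phi> x else inv_into Q \<psi> x)" for x
  have "B \<subseteq> P" using B by (metis Diff_subset)
  have "P - (P - \<psi> ` (Q - \<phi> ` B)) = \<psi> ` (Q - \<phi> ` B)"
    using assms(5) by (intro double_diff order_refl) blast
  then have comp: "P - B = \<psi> ` (Q - \<phi> ` B)"
    using B by metis
  have "bij_betw \<phi> B (\<phi> ` B)"
    by (intro inj_on_imp_bij_betw inj_on_subset[OF assms(1) \<open>B \<subseteq> P\<close>])
  then have "bij_betw h B (\<phi> ` B)"
    by (subst bij_betw_cong[of B h \<phi>]) (simp_all add: h_def)
  moreover have "bij_betw h (P - B) (Q - \<phi> ` B)"
  proof -
    have "h (\<psi> y) = y" if "y \<in> Q - \<phi> ` B" for y
    proof -
      have "\<psi> y \<notin> B" using that comp by (metis DiffD2 imageI)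
      then show ?thesis using that assms(4) by (simp add: h_def inv_into_f_f)
    qed
    then have "h ` \<psi> ` (Q - \<phi> ` B) = Q - \<phi> ` B" and "inj_on h (\<psi> ` (Q - \<phi> ` B))"
      by (simp_all add: image_image inj_on_def)
    then show ?thesis
      by (simp add: comp bij_betw_def)
  qed
  ultimately have "bij_betw h (B \<union> (P - B)) (\<phi> ` B \<union> (Q - \<phi> ` B))"
    by (rule bij_betw_combine) blast
  moreover have "B \<union> (P - B) = P" "\<phi> ` B \<union> (Q - \<phi> ` B) = Q"
    using \<open>B \<subseteq> P\<close> assms(2) by blast+
  moreover have "R x (h x)" if "x \<in> P" for x
  proof (cases "x \<in> B")
    case True
    then show ?thesis using assms(3) that by (simp add: h_def)
  next
    case False
    then have "x \<in> \<psi> ` (Q - \<phi> ` B)" using that comp by (metis DiffI)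
    then obtain y where "y \<in> Q" "x = \<psi> y" by (elim imageE DiffE)
    then show ?thesis using False assms(4,6) by (simp add: h_def inv_into_f_f)
  qed
  ultimately show ?thesis by auto
qed

section \<open>Matchings from a bound on the flow through finite sets\<close>

lemma card_le_mult_card_image:
  assumes "finite T" "\<pi> ` S \<subseteq> T" "\<And>z. z \<in> T \<Longrightarrow> finite {y\<in>S. \<pi> y = z} \<and> card {y\<in>S. \<pi> y = z} \<le> K"
  shows "finite S \<and> card S \<le> K * card T"
proof -
  have S: "S = (\<Union>z\<in>T. {y\<in>S. \<pi> y = z})" using assms(2) by blast
  have "card S \<le> (\<Sum>z\<in>T. card {y\<in>S. \<pi> y = z})"
    using card_UN_le[OF assms(1)] S by metis
  also have "\<dots> \<le> (\<Sum>z\<in>T. K)" using assms(3) by (intro sum_mono) blast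
  finally have "card S \<le> K * card T" by (simp add: mult.commute)
  moreover have "finite S"
    by (subst S) (use assms in blast)
  ultimately show ?thesis by blast
qed

definition neighbours :: "('z \<Rightarrow> 'z set) \<Rightarrow> 'z set \<Rightarrow> 'z set" where
  "neighbours N S = (\<Union>z\<in>S. N z)"

lemma neighbours_power_UN: "(neighbours N ^^ n) (\<Union>i\<in>J. S i) = (\<Union>i\<in>J. (neighbours N ^^ n) (S i))"
  by (induction n) (auto simp: neighbours_def)

text \<open>The hypothesis \<open>flow\<close> says that the excess of \<open>P\<close> over \<open>Q\<close> above a finite set can escape only through its
neighbouring points, at most \<open>D\<close> units through each. The excess is thus absorbed within \<open>D + 1\<close>
steps: surjectivity of both maps is what keeps the shells around a violating set from shrinking (otherwise
the leaves of ever taller trees could carry all of \<open>P\<close>, and the last points would have to travel to the root).\<close>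
lemma expansion_matching:
  fixes p :: "'p \<Rightarrow> 'z" and q :: "'q \<Rightarrow> 'z" and D :: nat
  assumes N: "\<And>z. z \<in> Z \<Longrightarrow> finite (N z) \<and> N z \<subseteq> Z \<and> z \<in> N z"
    and p: "p ` P = Z" "\<And>z. z \<in> Z \<Longrightarrow> finite {x\<in>P. p x = z}"
    and q: "q ` Q = Z" "\<And>z. z \<in> Z \<Longrightarrow> finite {y\<in>Q. q y = z}"
    and flow: "\<And>S. S \<subseteq> Z \<Longrightarrow> finite S \<Longrightarrow>
       card {x\<in>P. p x \<in> S} \<le> card {y\<in>Q. q y \<in> S} + D * card (neighbours N S - S)"
  shows "\<exists>\<phi>. inj_on \<phi> P \<and> \<phi> ` P \<subseteq> Q \<and> (\<forall>x\<in>P. q (\<phi> x) \<in> (neighbours N ^^ Suc D) {p x})"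
proof -
  let ?nb = "neighbours N"
  define pc where "pc S = card {x\<in>P. p x \<in> S}" for S
  define qc where "qc S = card {y\<in>Q. q y \<in> S}" for S
  have grow: "S \<subseteq> ?nb S \<and> finite (?nb S) \<and> ?nb S \<subseteq> Z" if "S \<subseteq> Z" "finite S" for S
    using that N unfolding neighbours_def by blast
  have iter: "finite ((?nb ^^ k) S) \<and> (?nb ^^ k) S \<subseteq> Z" if "S \<subseteq> Z" "finite S" for S k
    by (induction k) (use that grow in auto)
  have iter_mono: "(?nb ^^ k) S \<subseteq> (?nb ^^ l) S" if "S \<subseteq> Z" "finite S" "k \<le> l" for S k l
    using \<open>k \<le> l\<close>
  proof (induction rule: dec_induct)
    case (step n)
    then show ?case using grow iter[OF that(1,2)] by (metis funpow.simps(2) o_apply order_trans)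
  qed simp
  have fibre: "finite {x\<in>P. p x \<in> S}" "finite {y\<in>Q. q y \<in> S}" if "S \<subseteq> Z" "finite S" for S
  proof -
    have "{x\<in>P. p x \<in> S} = (\<Union>z\<in>S. {x\<in>P. p x = z})" "{y\<in>Q. q y \<in> S} = (\<Union>z\<in>S. {y\<in>Q. q y = z})" by auto
    then show "finite {x\<in>P. p x \<in> S}" "finite {y\<in>Q. q y \<in> S}"
      using that p(2) q(2) by auto
  qed
  have pc_grow: "pc S + card (T - S) \<le> pc T" and qc_grow: "qc S + card (T - S) \<le> qc T"
    if "S \<subseteq> T" "T \<subseteq> Z" "finite T" for S T
  proof -
    have "T - S \<subseteq> p ` P" "T - S \<subseteq> q ` Q"
      using that p(1) q(1) by auto
    then have surj: "T - S \<subseteq> p ` {x\<in>P. p x \<in> T - S}" "T - S \<subseteq> q ` {y\<in>Q. q y \<in> T - S}"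
      by blast+
    have sub: "T - S \<subseteq> Z" "finite (T - S)" "S \<subseteq> Z" "finite S"
      using that finite_subset by auto
    have "{x\<in>P. p x \<in> T} = {x\<in>P. p x \<in> S} \<union> {x\<in>P. p x \<in> T - S}"
      "{y\<in>Q. q y \<in> T} = {y\<in>Q. q y \<in> S} \<union> {y\<in>Q. q y \<in> T - S}"
      using that(1) by auto
    moreover have "{x\<in>P. p x \<in> S} \<inter> {x\<in>P. p x \<in> T - S} = {}"
      "{y\<in>Q. q y \<in> S} \<inter> {y\<in>Q. q y \<in> T - S} = {}"
      by auto
    ultimately have "pc T = pc S + pc (T - S)" "qc T = qc S + qc (T - S)"
      unfolding pc_def qc_def
      using fibre[OF sub(1,2)] fibre[OF sub(3,4)] by (simp_all only: card_Un_disjoint)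
    then show "pc S + card (T - S) \<le> pc T" "qc S + card (T - S) \<le> qc T"
      using surj_card_le[OF fibre(1)[OF sub(1,2)] surj(1)] surj_card_le[OF fibre(2)[OF sub(1,2)] surj(2)]
      by (simp_all add: pc_def qc_def)
  qed
  have key: "pc S \<le> qc ((?nb ^^ Suc D) S)" if S: "S \<subseteq> Z" "finite S" for S
  proof (rule ccontr)
    assume contra: "\<not> pc S \<le> qc ((?nb ^^ Suc D) S)"
    \<comment> \<open>\<open>D\<close> times each of the \<open>Suc D\<close> increments of \<open>s\<close> will exceed \<open>s (Suc D) - s 0\<close>, the sum of
      all these increments.\<close>
    define s where "s k = int (card ((?nb ^^ k) S))" for k
    have diff: "int (card ((?nb ^^ l) S - (?nb ^^ k) S)) = s l - s k" if "k \<le> l" for k l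
      using iter_mono[OF S that] iter[OF S]
      by (simp add: s_def card_Diff_subset of_nat_diff card_mono)
    have "1 + s (Suc D) - s 0 \<le> int D * (s (Suc k) - s k)" if "k < Suc D" for k
    proof -
      let ?T = "(?nb ^^ k) S"
      have T: "S \<subseteq> ?T" "?T \<subseteq> Z" "finite ?T" "?T \<subseteq> (?nb ^^ Suc D) S"
        using iter[OF S] iter_mono[OF S, of 0 k] iter_mono[OF S, of k "Suc D"] that by auto
      have "pc S + card (?T - S) \<le> pc ?T"
        using T by (intro pc_grow) auto
      moreover have "pc ?T \<le> qc ?T + D * card (?nb ?T - ?T)"
        unfolding pc_def qc_def using T by (intro flow) auto
      moreover have "qc ?T + card ((?nb ^^ Suc D) S - ?T) \<le> qc ((?nb ^^ Suc D) S)"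
        using T iter[OF S] by (intro qc_grow) blast+
      ultimately have "pc S + card (?T - S) + card ((?nb ^^ Suc D) S - ?T)
          \<le> qc ((?nb ^^ Suc D) S) + D * card (?nb ?T - ?T)"
        by linarith
      then have "int (pc S) + int (card (?T - S)) + int (card ((?nb ^^ Suc D) S - ?T))
          \<le> int (qc ((?nb ^^ Suc D) S)) + int D * int (card (?nb ?T - ?T))"
        unfolding of_nat_add[symmetric] of_nat_mult[symmetric] of_nat_le_iff .
      moreover have "int (card (?T - S)) = s k - s 0"
        "int (card (?nb ?T - ?T)) = s (Suc k) - s k"
        "int (card ((?nb ^^ Suc D) S - ?T)) = s (Suc D) - s k"
        using diff[of 0 k] diff[of k "Suc k"] diff[of k "Suc D"] that by simp_all
      ultimately have "int (pc S) + (s k - s 0) + (s (Suc D) - s k)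
          \<le> int (qc ((?nb ^^ Suc D) S)) + int D * (s (Suc k) - s k)"
        by metis
      then show ?thesis using contra by linarith
    qed
    then have "(\<Sum>k<Suc D. 1 + s (Suc D) - s 0) \<le> (\<Sum>k<Suc D. int D * (s (Suc k) - s k))"
      by (intro sum_mono) auto
    also have "\<dots> = int D * (s (Suc D) - s 0)"
      unfolding sum_distrib_left[symmetric] sum_lessThan_telescope ..
    finally have "int (Suc D) * (1 + s (Suc D) - s 0) \<le> int D * (s (Suc D) - s 0)"
      by simp
    moreover have "s 0 \<le> s (Suc D)"
      using diff[of 0 "Suc D"] by simp
    moreover have "int (Suc D) * (1 + s (Suc D) - s 0)
        = int D * (s (Suc D) - s 0) + (int D + 1 + (s (Suc D) - s 0))"
      by (simp add: algebra_simps)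
    ultimately show False by linarith
  qed
  define A where "A x = {y\<in>Q. q y \<in> (?nb ^^ Suc D) {p x}}" for x
  have "\<exists>\<phi>. inj_on \<phi> P \<and> (\<forall>x\<in>P. \<phi> x \<in> A x)"
  proof (rule hall_marriage)
    fix x assume "x \<in> P"
    then have "{p x} \<subseteq> Z" using p(1) by blast
    then show "finite (A x)"
      unfolding A_def by (intro fibre(2)) (use iter[of "{p x}"] in blast)+
  next
    fix J assume J: "J \<subseteq> P" "finite J"
    have S: "p ` J \<subseteq> Z" "finite (p ` J)" using J p(1) by auto
    have "p ` J = (\<Union>x\<in>J. {p x})" by auto
    then have "(\<Union>x\<in>J. A x) = {y\<in>Q. q y \<in> (?nb ^^ Suc D) (p ` J)}"
      unfolding A_def using neighbours_power_UN[of "Suc D" N "\<lambda>x. {p x}" J] by auto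
    then have "card (\<Union>x\<in>J. A x) = qc ((?nb ^^ Suc D) (p ` J))"
      by (simp add: qc_def)
    moreover have "card J \<le> pc (p ` J)"
      unfolding pc_def by (rule card_mono[OF fibre(1)[OF S]]) (use J in auto)
    ultimately show "card J \<le> card (\<Union>x\<in>J. A x)"
      using key[OF S] by linarith
  qed
  then show ?thesis unfolding A_def by blast
qed

section \<open>Uniformly finite chains and maps of tuples\<close>

definition tuples :: "'a::metric_space set \<Rightarrow> nat \<Rightarrow> real \<Rightarrow> 'a list set" where
  "tuples X n \<rho> = {xs. length xs = Suc n \<and> set xs \<subseteq> X \<and> (\<forall>x\<in>set xs. \<forall>y\<in>set xs. dist x y \<le> \<rho>)}"

lemma tuples_mono: "\<rho> \<le> \<sigma> \<Longrightarrow> tuples X n \<rho> \<subseteq> tuples X n \<sigma>"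
  by (fastforce simp: tuples_def)

lemma hd_in_tuple: "xs \<in> tuples X n \<rho> \<Longrightarrow> hd xs \<in> set xs \<and> hd xs \<in> X"
  by (cases xs) (auto simp: tuples_def)

lemma uf_chains_iff:
  "c \<in> uf_chains X n \<longleftrightarrow>
     (\<exists>B. \<forall>xs. \<bar>c xs\<bar> \<le> B) \<and> (\<exists>\<rho>. \<forall>xs. c xs \<noteq> 0 \<longrightarrow> xs \<in> tuples X n \<rho>)"
proof
  assume "c \<in> uf_chains X n"
  then obtain B \<rho> where "\<forall>xs. \<not> (length xs = Suc n \<and> set xs \<subseteq> X) \<longrightarrow> c xs = 0"
    "\<forall>xs. \<bar>c xs\<bar> \<le> B" "\<forall>xs. (\<exists>x\<in>set xs. \<exists>y\<in>set xs. dist x y > \<rho>) \<longrightarrow> c xs = 0"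
    by (auto simp: uf_chains_def bdd_above_def)
  then show "(\<exists>B. \<forall>xs. \<bar>c xs\<bar> \<le> B) \<and> (\<exists>\<rho>. \<forall>xs. c xs \<noteq> 0 \<longrightarrow> xs \<in> tuples X n \<rho>)"
    unfolding tuples_def by (smt (verit, best) mem_Collect_eq)
next
  assume "(\<exists>B. \<forall>xs. \<bar>c xs\<bar> \<le> B) \<and> (\<exists>\<rho>. \<forall>xs. c xs \<noteq> 0 \<longrightarrow> xs \<in> tuples X n \<rho>)"
  then obtain B \<rho> where B: "\<forall>xs. \<bar>c xs\<bar> \<le> B" and \<rho>: "\<forall>xs. c xs \<noteq> 0 \<longrightarrow> xs \<in> tuples X n \<rho>"
    by blast
  have "c xs = 0" if "x \<in> set xs" "y \<in> set xs" "dist x y > max \<rho> 1" for x y xs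
    using \<rho> that by (force simp: tuples_def)
  then have "\<exists>\<rho>>0. \<forall>xs. (\<exists>x\<in>set xs. \<exists>y\<in>set xs. dist x y > \<rho>) \<longrightarrow> c xs = 0"
    by (intro exI[of _ "max \<rho> 1"]) auto
  then show "c \<in> uf_chains X n"
    using B \<rho> by (auto simp: uf_chains_def bdd_above_def tuples_def)
qed

lemma uf_chainsE:
  assumes "c \<in> uf_chains X n"
  obtains B \<rho> where "\<And>xs. \<bar>c xs\<bar> \<le> B" "\<And>xs. c xs \<noteq> 0 \<Longrightarrow> xs \<in> tuples X n \<rho>"
  using assms uf_chains_iff by metis

lemma uf_chains_lincomb:
  fixes s :: "'i \<Rightarrow> int"
  assumes "finite I" "\<And>i. i \<in> I \<Longrightarrow> c i \<in> uf_chains X n"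
  shows "(\<lambda>xs. \<Sum>i\<in>I. s i * c i xs) \<in> uf_chains X n"
proof -
  have "\<exists>B. \<forall>i\<in>I. \<forall>xs. \<bar>c i xs\<bar> \<le> B i"
    by (rule bchoice) (use assms(2) in \<open>simp add: uf_chains_iff\<close>)
  then obtain B where B: "\<And>i xs. i \<in> I \<Longrightarrow> \<bar>c i xs\<bar> \<le> B i" by blast
  have "\<exists>\<rho>. \<forall>i\<in>I. \<forall>xs. c i xs \<noteq> 0 \<longrightarrow> xs \<in> tuples X n (\<rho> i)"
    by (rule bchoice) (use assms(2) in \<open>simp add: uf_chains_iff\<close>)
  then obtain \<rho> where \<rho>: "\<And>i xs. i \<in> I \<Longrightarrow> c i xs \<noteq> 0 \<Longrightarrow> xs \<in> tuples X n (\<rho> i)" by blast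
  have "\<bar>\<Sum>i\<in>I. s i * c i xs\<bar> \<le> (\<Sum>i\<in>I. \<bar>s i\<bar> * B i)" for xs
    by (rule order_trans[OF sum_abs]) (auto simp: abs_mult B intro!: sum_mono mult_left_mono)
  moreover have "xs \<in> tuples X n (\<Sum>i\<in>I. \<bar>\<rho> i\<bar>)" if nz: "(\<Sum>i\<in>I. s i * c i xs) \<noteq> 0" for xs
  proof -
    obtain i where i: "i \<in> I" "c i xs \<noteq> 0"
      using nz by (metis (mono_tags, lifting) mult_zero_right sum.neutral)
    have "\<rho> i \<le> \<bar>\<rho> i\<bar>" by simp
    also have "\<dots> \<le> (\<Sum>i\<in>I. \<bar>\<rho> i\<bar>)"
      using i assms(1) by (intro member_le_sum) auto
    finally show ?thesis
      using \<rho>[OF i] tuples_mono by blast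
  qed
  ultimately show ?thesis
    unfolding uf_chains_iff by blast
qed

lemma uf_chains_zero: "(\<lambda>_. 0) \<in> uf_chains X n"
  by (auto simp: uf_chains_iff)

lemma uf_chains_add:
  assumes "c \<in> uf_chains X n" "d \<in> uf_chains X n"
  shows "(\<lambda>xs. c xs + d xs) \<in> uf_chains X n"
proof -
  have "(\<lambda>xs. \<Sum>b\<in>UNIV. 1 * (if b then c else d) xs) \<in> uf_chains X n"
    using assms by (intro uf_chains_lincomb) auto
  then show ?thesis by (simp add: UNIV_bool add.commute)
qed

lemma uf_chains_uminus:
  assumes "c \<in> uf_chains X n"
  shows "(\<lambda>xs. - c xs) \<in> uf_chains X n"
  using uf_chains_lincomb[of "{()}" "\<lambda>_. c" X n "\<lambda>_. -1"] assms by simp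

text \<open>Tuples of diameter at most \<open>\<rho>\<close> are the simplices of a Rips complex; \<open>\<phi>\<close> is controlled if it is a
coarse embedding of these complexes. Distances between tuples are measured at their first
entries, which is harmless since diameters are bounded. Taking the larger one lets a single
\<open>\<rho>\<close> bound both the diameters in the source and the distance in the target.\<close>
definition controlled ::
    "'a::metric_space set \<Rightarrow> nat \<Rightarrow> 'b::metric_space set \<Rightarrow> nat \<Rightarrow> ('a list \<Rightarrow> 'b list) \<Rightarrow> bool" where
  "controlled X n Y m \<phi> \<longleftrightarrow> (\<forall>\<rho>. \<exists>R. (\<forall>xs\<in>tuples X n \<rho>. \<phi> xs \<in> tuples Y m R) \<and>
     (\<forall>xs\<in>tuples X n \<rho>. \<forall>xs'\<in>tuples X n \<rho>.
        dist (hd (\<phi> xs)) (hd (\<phi> xs')) \<le> \<rho> \<longrightarrow> dist (hd xs) (hd xs') \<le> R))"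

lemma controlledE:
  assumes "controlled X n Y m \<phi>"
  obtains R where "\<And>xs. xs \<in> tuples X n \<rho> \<Longrightarrow> \<phi> xs \<in> tuples Y m R"
    "\<And>xs xs'. \<lbrakk>xs \<in> tuples X n \<rho>; xs' \<in> tuples X n \<rho>; dist (hd (\<phi> xs)) (hd (\<phi> xs')) \<le> \<rho>\<rbrakk>
       \<Longrightarrow> dist (hd xs) (hd xs') \<le> R"
  using assms unfolding controlled_def by metis

lemma controlled_comp:
  assumes \<psi>: "controlled X n Y m \<psi>" and \<phi>: "controlled Y m Z k \<phi>"
  shows "controlled X n Z k (\<phi> \<circ> \<psi>)"
  unfolding controlled_def
proof (rule allI)
  fix \<rho>
  obtain R1 where R1: "\<And>xs. xs \<in> tuples X n \<rho> \<Longrightarrow> \<psi> xs \<in> tuples Y m R1"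
    using controlledE[OF \<psi>, of \<rho>] by metis
  obtain R2 where R2: "\<And>xs. xs \<in> tuples Y m (max \<rho> R1) \<Longrightarrow> \<phi> xs \<in> tuples Z k R2"
    "\<And>xs xs'. \<lbrakk>xs \<in> tuples Y m (max \<rho> R1); xs' \<in> tuples Y m (max \<rho> R1);
       dist (hd (\<phi> xs)) (hd (\<phi> xs')) \<le> max \<rho> R1\<rbrakk> \<Longrightarrow> dist (hd xs) (hd xs') \<le> R2"
    using controlledE[OF \<phi>, of "max \<rho> R1"] by metis
  obtain R3 where R3: "\<And>xs xs'. \<lbrakk>xs \<in> tuples X n (max \<rho> R2); xs' \<in> tuples X n (max \<rho> R2);
       dist (hd (\<psi> xs)) (hd (\<psi> xs')) \<le> max \<rho> R2\<rbrakk> \<Longrightarrow> dist (hd xs) (hd xs') \<le> R3"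
    using controlledE[OF \<psi>, of "max \<rho> R2"] by metis
  have sub: "tuples X n \<rho> \<subseteq> tuples X n (max \<rho> R2)" "tuples Y m R1 \<subseteq> tuples Y m (max \<rho> R1)"
    "tuples Z k R2 \<subseteq> tuples Z k (max R2 R3)"
    by (simp_all add: tuples_mono)
  have in_Z: "(\<phi> \<circ> \<psi>) xs \<in> tuples Z k (max R2 R3)" if "xs \<in> tuples X n \<rho>" for xs
    using R1[OF that] R2(1) sub by auto
  have "dist (hd xs) (hd xs') \<le> max R2 R3"
    if xs: "xs \<in> tuples X n \<rho>" "xs' \<in> tuples X n \<rho>" "dist (hd ((\<phi> \<circ> \<psi>) xs)) (hd ((\<phi> \<circ> \<psi>) xs')) \<le> \<rho>"
    for xs xs'
  proof -
    have "dist (hd (\<psi> xs)) (hd (\<psi> xs')) \<le> R2"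
      using xs R1[of xs] R1[of xs'] sub(2) by (intro R2(2)) auto
    then have "dist (hd xs) (hd xs') \<le> R3"
      using xs sub(1) by (intro R3) auto
    then show ?thesis by simp
  qed
  with in_Z show "\<exists>R. (\<forall>xs\<in>tuples X n \<rho>. (\<phi> \<circ> \<psi>) xs \<in> tuples Z k R) \<and>
      (\<forall>xs\<in>tuples X n \<rho>. \<forall>xs'\<in>tuples X n \<rho>.
         dist (hd ((\<phi> \<circ> \<psi>) xs)) (hd ((\<phi> \<circ> \<psi>) xs')) \<le> \<rho> \<longrightarrow> dist (hd xs) (hd xs') \<le> R)"
    by blast
qed

text \<open>The one source of controlled maps: faces, induced maps and prisms all produce tuples whose entries are
images of the original entries under one of two close maps.\<close>
lemma controlled_if_vertices_in_images:
  assumes f: "qi_embedding X Y f" and f': "f' \<in> X \<rightarrow> Y" and close: "uniformly_close X f f'"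
    and \<phi>: "\<And>xs. length xs = Suc n \<Longrightarrow> length (\<phi> xs) = Suc m \<and> set (\<phi> xs) \<subseteq> f ` set xs \<union> f' ` set xs"
  shows "controlled X n Y m \<phi>"
  unfolding controlled_def
proof (rule allI)
  fix \<rho>
  obtain C D where "C > 0" and qi: "\<And>x x'. x \<in> X \<Longrightarrow> x' \<in> X \<Longrightarrow>
      1 / C * dist x x' - D \<le> dist (f x) (f x') \<and> dist (f x) (f x') \<le> C * dist x x' + D"
    and fY: "f \<in> X \<rightarrow> Y"
    using f unfolding qi_embedding_def by blast
  obtain M where M: "\<And>x. x \<in> X \<Longrightarrow> dist (f x) (f' x) \<le> M"
    using close unfolding uniformly_close_def bdd_above_def by blast
  define E where "E = C * \<rho> + D + \<bar>M\<bar>"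
  have near: "dist (f (hd xs)) y \<le> E" if xs: "xs \<in> tuples X n \<rho>" and y: "y \<in> set (\<phi> xs)" for xs y
  proof -
    have "length xs = Suc n" using xs by (simp add: tuples_def)
    then obtain x where x: "x \<in> set xs" "y = f x \<or> y = f' x"
      using \<phi>[of xs] y by blast
    have X: "x \<in> X" "hd xs \<in> X" "dist (hd xs) x \<le> \<rho>"
      using xs x hd_in_tuple[OF xs] by (auto simp: tuples_def)
    have "dist (f (hd xs)) (f x) \<le> C * dist (hd xs) x + D"
      using qi X by blast
    also have "\<dots> \<le> C * \<rho> + D"
      using X \<open>C > 0\<close> by simp
    finally have "dist (f (hd xs)) (f x) \<le> C * \<rho> + D" .
    moreover have "dist (f x) y \<le> \<bar>M\<bar>"
      using x M[OF X(1)] by auto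
    ultimately show ?thesis
      using dist_triangle[of "f (hd xs)" y "f x"] unfolding E_def by linarith
  qed
  define R where "R = max (2 * E) (C * (\<rho> + 2 * E + D))"
  have "\<phi> xs \<in> tuples Y m R" if xs: "xs \<in> tuples X n \<rho>" for xs
  proof -
    have "set xs \<subseteq> X" "length xs = Suc n" using xs by (auto simp: tuples_def)
    then have "length (\<phi> xs) = Suc m" "set (\<phi> xs) \<subseteq> Y"
      using \<phi>[of xs] fY f' by (auto; blast)+
    moreover have "dist x y \<le> R" if "x \<in> set (\<phi> xs)" "y \<in> set (\<phi> xs)" for x y
      using near[OF xs that(1)] near[OF xs that(2)] dist_triangle3[of x y "f (hd xs)"]
      unfolding R_def by linarith
    ultimately show ?thesis by (simp add: tuples_def)
  qed
  moreover have "dist (hd xs) (hd xs') \<le> R"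
    if xs: "xs \<in> tuples X n \<rho>" "xs' \<in> tuples X n \<rho>" and le: "dist (hd (\<phi> xs)) (hd (\<phi> xs')) \<le> \<rho>" for xs xs'
  proof -
    have "length (\<phi> xs) = Suc m" "length (\<phi> xs') = Suc m"
      using \<phi> xs by (auto simp: tuples_def)
    then have "hd (\<phi> xs) \<in> set (\<phi> xs)" "hd (\<phi> xs') \<in> set (\<phi> xs')"
      by (metis hd_in_set list.size(3) nat.distinct(1))+
    then have "dist (f (hd xs)) (f (hd xs')) \<le> \<rho> + 2 * E"
      using near[OF xs(1)] near[OF xs(2)] le
        dist_triangle[of "f (hd xs)" "f (hd xs')" "hd (\<phi> xs)"]
        dist_triangle3[of "hd (\<phi> xs)" "f (hd xs')" "hd (\<phi> xs')"]
      by (smt (verit) dist_commute)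
    moreover have "1 / C * dist (hd xs) (hd xs') - D \<le> dist (f (hd xs)) (f (hd xs'))"
      using qi hd_in_tuple[OF xs(1)] hd_in_tuple[OF xs(2)] by blast
    ultimately have "1 / C * dist (hd xs) (hd xs') \<le> \<rho> + 2 * E + D" by linarith
    then have "dist (hd xs) (hd xs') \<le> C * (\<rho> + 2 * E + D)"
      using \<open>C > 0\<close> by (simp add: field_simps)
    then show ?thesis by (simp add: R_def)
  qed
  ultimately show "\<exists>R. (\<forall>xs\<in>tuples X n \<rho>. \<phi> xs \<in> tuples Y m R) \<and>
      (\<forall>xs\<in>tuples X n \<rho>. \<forall>xs'\<in>tuples X n \<rho>.
         dist (hd (\<phi> xs)) (hd (\<phi> xs')) \<le> \<rho> \<longrightarrow> dist (hd xs) (hd xs') \<le> R)"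
    by blast
qed

lemma qi_embedding_id: "qi_embedding X X id"
  unfolding qi_embedding_def by (intro conjI exI[of _ 1]) auto

lemma uniformly_close_refl: "uniformly_close X f f"
  by (auto simp: uniformly_close_def)

lemma controlled_map:
  assumes "qi_embedding X Y f"
  shows "controlled X n Y n (map f)"
  by (rule controlled_if_vertices_in_images[OF assms _ uniformly_close_refl])
    (use assms in \<open>auto simp: qi_embedding_def\<close>)

lemma length_face: "j < length xs \<Longrightarrow> length (face j xs) = length xs - 1"
  by (simp add: face_def)

lemma nth_face: "j < length xs \<Longrightarrow> k < length xs - 1 \<Longrightarrow> face j xs ! k = (if k < j then xs ! k else xs ! Suc k)"
  by (auto simp: face_def nth_append min_def)

lemma set_face_subset: "set (face j xs) \<subseteq> set xs"
  using set_take_subset[of j xs] set_drop_subset[of "Suc j" xs] by (auto simp: face_def)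

lemma controlled_face:
  assumes "j \<le> Suc n"
  shows "controlled X (Suc n) X n (face j)"
proof (rule controlled_if_vertices_in_images[OF qi_embedding_id _ uniformly_close_refl])
  fix xs :: "'a list" assume "length xs = Suc (Suc n)"
  then show "length (face j xs) = Suc n \<and> set (face j xs) \<subseteq> id ` set xs \<union> id ` set xs"
    using assms set_face_subset[of j xs] by (simp add: length_face)
qed simp

text \<open>Two tuples with the same image start at nearby points, so a fibre lies in the tuples over one ball, whose number is
bounded by bounded geometry. The uniform bound keeps coefficients bounded under \<open>formal_extension\<close>, and finiteness makes its sums
meaningful.\<close>
lemma controlled_fibres:
  assumes X: "UDBG X" and \<phi>: "controlled X n Y m \<phi>"
  shows "\<exists>K. \<forall>ys. finite {xs \<in> tuples X n \<rho>. \<phi> xs = ys} \<and> card {xs \<in> tuples X n \<rho>. \<phi> xs = ys} \<le> K"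
proof -
  obtain R where R: "\<And>xs xs'. \<lbrakk>xs \<in> tuples X n (max \<rho> 0); xs' \<in> tuples X n (max \<rho> 0);
      dist (hd (\<phi> xs)) (hd (\<phi> xs')) \<le> max \<rho> 0\<rbrakk> \<Longrightarrow> dist (hd xs) (hd xs') \<le> R"
    using controlledE[OF \<phi>, of "max \<rho> 0"] by metis
  define r where "r = \<bar>R\<bar> + \<bar>\<rho>\<bar> + 1"
  obtain K where K: "\<And>x. x \<in> X \<Longrightarrow> finite (X \<inter> ball x r) \<and> card (X \<inter> ball x r) < K"
    using X unfolding UDBG_def r_def by (metis abs_ge_zero add_nonneg_pos add_nonneg_nonneg zero_less_one)
  have "finite {xs \<in> tuples X n \<rho>. \<phi> xs = ys} \<and> card {xs \<in> tuples X n \<rho>. \<phi> xs = ys} \<le> K ^ Suc n" for ys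
  proof (cases "{xs \<in> tuples X n \<rho>. \<phi> xs = ys} = {}")
    case False
    then obtain xs0 where xs0: "xs0 \<in> tuples X n \<rho>" "\<phi> xs0 = ys" by blast
    let ?B = "X \<inter> ball (hd xs0) r"
    let ?L = "{xs. set xs \<subseteq> ?B \<and> length xs = Suc n}"
    have B: "finite ?B" "card ?B \<le> K"
      using K hd_in_tuple[OF xs0(1)] less_imp_le by blast+
    have sub: "{xs \<in> tuples X n \<rho>. \<phi> xs = ys} \<subseteq> ?L"
    proof (intro subsetI CollectI conjI)
      fix xs x assume xs: "xs \<in> {xs \<in> tuples X n \<rho>. \<phi> xs = ys}" and x: "x \<in> set xs"
      have mem: "xs \<in> tuples X n (max \<rho> 0)" "xs0 \<in> tuples X n (max \<rho> 0)"
        using xs xs0 tuples_mono[of \<rho> "max \<rho> 0" X n] by auto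
      have "dist (hd xs0) (hd xs) \<le> R"
        using mem xs xs0 by (intro R) auto
      moreover have "dist (hd xs) x \<le> \<rho>"
        using xs x hd_in_tuple[of xs X n \<rho>] by (auto simp: tuples_def)
      ultimately have "dist (hd xs0) x < r"
        unfolding r_def using dist_triangle[of "hd xs0" x "hd xs"] by linarith
      then show "x \<in> ?B" using xs x by (auto simp: tuples_def)
    qed (auto simp: tuples_def)
    have "card {xs \<in> tuples X n \<rho>. \<phi> xs = ys} \<le> card ?L"
      using sub B(1) by (intro card_mono finite_lists_length_eq)
    also have "\<dots> = card ?B ^ Suc n"
      using B(1) by (rule card_lists_length_eq)
    also have "\<dots> \<le> K ^ Suc n" using B(2) by (rule power_mono) simp
    finally show ?thesis
      using finite_subset[OF sub finite_lists_length_eq[OF B(1)]] by blast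
  next
    case True
    then show ?thesis by (metis card.empty finite.emptyI zero_le)
  qed
  then show ?thesis by blast
qed

lemma formal_extension_eq_sum:
  assumes "finite F" "\<And>xs. xs \<in> F \<Longrightarrow> \<phi> xs = ys" "\<And>xs. c xs \<noteq> 0 \<Longrightarrow> \<phi> xs = ys \<Longrightarrow> xs \<in> F"
  shows "formal_extension \<phi> c ys = sum c F"
  unfolding formal_extension_def
  by (rule sum.mono_neutral_left) (use assms in auto)

lemma formal_extension_nonzeroE:
  assumes "formal_extension \<phi> c ys \<noteq> 0"
  obtains xs where "c xs \<noteq> 0" "\<phi> xs = ys"
proof -
  have "{xs. c xs \<noteq> 0 \<and> \<phi> xs = ys} \<noteq> {}"
    using assms unfolding formal_extension_def by (metis sum.empty)
  then show ?thesis using that by blast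
qed

lemma formal_extension_cong:
  assumes "\<And>xs. c xs \<noteq> 0 \<Longrightarrow> \<phi> xs = \<psi> xs"
  shows "formal_extension \<phi> c = formal_extension \<psi> c"
  unfolding formal_extension_def using assms by (intro ext sum.cong) auto

lemma formal_extension_id: "formal_extension id c = c"
proof
  fix xs show "formal_extension id c xs = c xs"
    by (subst formal_extension_eq_sum[where F = "{xs}"]) auto
qed

context
  fixes X :: "'a::metric_space set" and Y :: "'b::metric_space set" and \<phi> n m
  assumes X: "UDBG X" and \<phi>: "controlled X n Y m \<phi>"
begin

lemma finite_support_fibre:
  assumes "c \<in> uf_chains X n"
  shows "finite {xs. c xs \<noteq> 0 \<and> \<phi> xs = ys}"
proof -
  obtain B \<rho> where "\<And>xs. c xs \<noteq> 0 \<Longrightarrow> xs \<in> tuples X n \<rho>" using uf_chainsE[OF assms] by metis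
  then have "{xs. c xs \<noteq> 0 \<and> \<phi> xs = ys} \<subseteq> {xs \<in> tuples X n \<rho>. \<phi> xs = ys}" by blast
  moreover have "finite {xs \<in> tuples X n \<rho>. \<phi> xs = ys}"
    using controlled_fibres[OF X \<phi>, of \<rho>] by blast
  ultimately show ?thesis by (rule finite_subset)
qed

lemma formal_extension_in_uf_chains:
  assumes "c \<in> uf_chains X n"
  shows "formal_extension \<phi> c \<in> uf_chains Y m"
proof -
  obtain B \<rho> where B: "\<And>xs. \<bar>c xs\<bar> \<le> B" and \<rho>: "\<And>xs. c xs \<noteq> 0 \<Longrightarrow> xs \<in> tuples X n \<rho>"
    using uf_chainsE[OF assms] by metis
  obtain K where K: "\<And>ys. finite {xs \<in> tuples X n \<rho>. \<phi> xs = ys}"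
    "\<And>ys. card {xs \<in> tuples X n \<rho>. \<phi> xs = ys} \<le> K"
    using controlled_fibres[OF X \<phi>, of \<rho>] by blast
  obtain R where R: "\<And>xs. xs \<in> tuples X n \<rho> \<Longrightarrow> \<phi> xs \<in> tuples Y m R"
    using controlledE[OF \<phi>, of \<rho>] by metis
  have "B \<ge> 0" using B[of undefined] by linarith
  have "\<bar>formal_extension \<phi> c ys\<bar> \<le> int K * B" for ys
  proof -
    have "formal_extension \<phi> c ys = sum c {xs \<in> tuples X n \<rho>. \<phi> xs = ys}"
      using K(1) \<rho> by (intro formal_extension_eq_sum) auto
    also have "\<bar>\<dots>\<bar> \<le> of_nat (card {xs \<in> tuples X n \<rho>. \<phi> xs = ys}) * B"
      by (rule order_trans[OF sum_abs sum_bounded_above]) (rule B)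
    also have "\<dots> \<le> int K * B"
      using K(2) \<open>B \<ge> 0\<close> by (intro mult_right_mono) auto
    finally show ?thesis .
  qed
  moreover have "ys \<in> tuples Y m R" if nz: "formal_extension \<phi> c ys \<noteq> 0" for ys
  proof -
    obtain xs where "c xs \<noteq> 0" "\<phi> xs = ys"
      using formal_extension_nonzeroE[OF nz] by blast
    then show ?thesis using R \<rho> by blast
  qed
  ultimately show ?thesis unfolding uf_chains_iff by blast
qed

lemma formal_extension_lincomb:
  fixes s :: "'i \<Rightarrow> int"
  assumes I: "finite I" and c: "\<And>i. i \<in> I \<Longrightarrow> c i \<in> uf_chains X n"
  shows "formal_extension \<phi> (\<lambda>xs. \<Sum>i\<in>I. s i * c i xs) ys = (\<Sum>i\<in>I. s i * formal_extension \<phi> (c i) ys)"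
proof -
  define F where "F = (\<Union>i\<in>I. {xs. c i xs \<noteq> 0 \<and> \<phi> xs = ys})"
  have F: "finite F"
    unfolding F_def using I c finite_support_fibre by blast
  have "formal_extension \<phi> (\<lambda>xs. \<Sum>i\<in>I. s i * c i xs) ys = (\<Sum>xs\<in>F. \<Sum>i\<in>I. s i * c i xs)"
  proof (rule formal_extension_eq_sum[OF F])
    fix xs assume nz: "(\<Sum>i\<in>I. s i * c i xs) \<noteq> 0" and xs: "\<phi> xs = ys"
    obtain i where "i \<in> I" "s i * c i xs \<noteq> 0"
      using sum.not_neutral_contains_not_neutral[OF nz] by blast
    then show "xs \<in> F" using xs by (auto simp: F_def)
  qed (auto simp: F_def)
  also have "\<dots> = (\<Sum>i\<in>I. s i * sum (c i) F)"
    by (subst sum.swap) (simp add: sum_distrib_left)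
  also have "\<dots> = (\<Sum>i\<in>I. s i * formal_extension \<phi> (c i) ys)"
    using F by (intro sum.cong arg_cong[where f = "(*) _"] formal_extension_eq_sum[symmetric])
      (auto simp: F_def)
  finally show ?thesis .
qed

lemma formal_extension_add:
  assumes "c \<in> uf_chains X n" "d \<in> uf_chains X n"
  shows "formal_extension \<phi> (\<lambda>xs. c xs + d xs) = (\<lambda>ys. formal_extension \<phi> c ys + formal_extension \<phi> d ys)"
proof
  fix ys
  have "formal_extension \<phi> (\<lambda>xs. \<Sum>b\<in>UNIV. 1 * (if b then c else d) xs) ys
      = (\<Sum>b\<in>UNIV. 1 * formal_extension \<phi> (if b then c else d) ys)"
    using assms by (intro formal_extension_lincomb) auto
  then show "formal_extension \<phi> (\<lambda>xs. c xs + d xs) ys = formal_extension \<phi> c ys + formal_extension \<phi> d ys"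
    by (simp add: UNIV_bool add.commute)
qed

end

lemma formal_extension_uminus: "formal_extension \<phi> (\<lambda>xs. - c xs) = (\<lambda>ys. - formal_extension \<phi> c ys)"
  unfolding formal_extension_def by (simp add: sum_negf)

text \<open>The sums over the fibres of \<open>\<psi>\<close> inside a fibre of \<open>\<phi>\<close> regroup the sum over the corresponding fibre of the
composite, which is finite because the composite is controlled as well.\<close>
lemma formal_extension_comp:
  assumes X: "UDBG X" and \<psi>: "controlled X n Y m \<psi>" and \<phi>: "controlled Y m Z k \<phi>"
    and c: "c \<in> uf_chains X n"
  shows "formal_extension \<phi> (formal_extension \<psi> c) = formal_extension (\<phi> \<circ> \<psi>) c"
proof
  fix zs
  define F where "F = {xs. c xs \<noteq> 0 \<and> (\<phi> \<circ> \<psi>) xs = zs}"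
  have F: "finite F"
    unfolding F_def by (rule finite_support_fibre[OF X controlled_comp[OF \<psi> \<phi>] c])
  have "formal_extension \<phi> (formal_extension \<psi> c) zs = sum (formal_extension \<psi> c) (\<psi> ` F)"
  proof (rule formal_extension_eq_sum)
    fix ys assume ys: "formal_extension \<psi> c ys \<noteq> 0" "\<phi> ys = zs"
    then obtain xs where "c xs \<noteq> 0" "\<psi> xs = ys"
      using formal_extension_nonzeroE by blast
    then show "ys \<in> \<psi> ` F" using ys by (auto simp: F_def)
  qed (use F in \<open>auto simp: F_def\<close>)
  also have "\<dots> = (\<Sum>ys\<in>\<psi> ` F. sum c {xs\<in>F. \<psi> xs = ys})"
    using F by (intro sum.cong formal_extension_eq_sum finite_Collect_conjI disjI1)
      (auto simp: F_def)
  also have "\<dots> = sum c F"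
    using F by (intro sum.group) auto
  also have "\<dots> = formal_extension (\<phi> \<circ> \<psi>) c zs"
    using F by (intro formal_extension_eq_sum[symmetric]) (auto simp: F_def)
  finally show "formal_extension \<phi> (formal_extension \<psi> c) zs = formal_extension (\<phi> \<circ> \<psi>) c zs" .
qed

section \<open>The boundary operator\<close>

lemma uf_boundary_Suc:
  "uf_boundary (Suc n) c = (\<lambda>ys. \<Sum>j\<le>Suc n. (- 1) ^ j * formal_extension (face j) c ys)"
  by (simp add: uf_boundary_def)

lemma face_chains:
  assumes "UDBG X" "c \<in> uf_chains X (Suc n)" "j \<le> Suc n"
  shows "formal_extension (face j) c \<in> uf_chains X n"
  by (rule formal_extension_in_uf_chains[OF assms(1) controlled_face[OF assms(3)] assms(2)])

lemma uf_boundary_in_uf_chains: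
  assumes "UDBG X" "c \<in> uf_chains X (Suc n)"
  shows "uf_boundary (Suc n) c \<in> uf_chains X n"
  unfolding uf_boundary_Suc using assms by (intro uf_chains_lincomb face_chains) auto

lemma uf_boundary_add:
  assumes "UDBG X" "c \<in> uf_chains X n" "d \<in> uf_chains X n"
  shows "uf_boundary n (\<lambda>xs. c xs + d xs) = (\<lambda>ys. uf_boundary n c ys + uf_boundary n d ys)"
proof (cases n)
  case (Suc m)
  have "formal_extension (face j) (\<lambda>xs. c xs + d xs)
      = (\<lambda>ys. formal_extension (face j) c ys + formal_extension (face j) d ys)" if "j \<le> Suc m" for j
    using assms that Suc by (intro formal_extension_add[OF _ controlled_face]) auto
  then have "(\<Sum>j\<le>Suc m. (- 1) ^ j * formal_extension (face j) (\<lambda>xs. c xs + d xs) ys)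
      = (\<Sum>j\<le>Suc m. (- 1) ^ j * formal_extension (face j) c ys + (- 1) ^ j * formal_extension (face j) d ys)" for ys
    by (intro sum.cong) (simp_all add: distrib_left)
  then show ?thesis
    unfolding Suc uf_boundary_Suc by (simp only: sum.distrib)
qed (simp add: uf_boundary_def)

lemma uf_boundary_uminus: "uf_boundary n (\<lambda>xs. - c xs) = (\<lambda>ys. - uf_boundary n c ys)"
  by (simp add: uf_boundary_def formal_extension_uminus sum_negf)

lemma face_face:
  assumes "length xs = Suc (Suc (Suc n))" "i < j" "j \<le> Suc (Suc n)"
  shows "face i (face j xs) = face (j - 1) (face i xs)"
  using assms by (intro nth_equalityI) (auto simp: length_face nth_face)

text \<open>The familiar cancellation: deleting \<open>j\<close> and then \<open>i < j\<close> equals deleting \<open>i\<close> and then \<open>j - 1\<close>, with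
opposite signs.\<close>
lemma uf_boundary_boundary:
  assumes X: "UDBG X" and c: "c \<in> uf_chains X (Suc (Suc n))"
  shows "uf_boundary (Suc n) (uf_boundary (Suc (Suc n)) c) = (\<lambda>_. 0)"
proof
  fix ys
  define G where "G = (\<lambda>(i, j). (- 1) ^ (i + j) * formal_extension (face i \<circ> face j) c ys)"
  define A where "A = {(i, j). i \<le> Suc n \<and> j \<le> Suc (Suc n) \<and> i < j}"
  define B where "B = {(i, j). i \<le> Suc n \<and> j \<le> i}"
  have fin: "finite A" "finite B"
    by (rule finite_subset[of _ "{..Suc n} \<times> {..Suc (Suc n)}"]; auto simp: A_def B_def)+
  have "uf_boundary (Suc n) (uf_boundary (Suc (Suc n)) c) ys
      = (\<Sum>i\<le>Suc n. (- 1) ^ i * (\<Sum>j\<le>Suc (Suc n). (- 1) ^ j * formal_extension (face i) (formal_extension (face j) c) ys))"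
    unfolding uf_boundary_Suc
    by (intro sum.cong refl arg_cong[where f = "(*) _"]
        formal_extension_lincomb[OF X controlled_face]) (auto intro: face_chains[OF X c])
  also have "\<dots> = (\<Sum>i\<le>Suc n. \<Sum>j\<le>Suc (Suc n). G (i, j))"
    unfolding sum_distrib_left G_def
    by (intro sum.cong refl)
      (simp add: power_add mult.assoc formal_extension_comp[OF X controlled_face controlled_face c])
  also have "\<dots> = sum G ({..Suc n} \<times> {..Suc (Suc n)})"
    by (simp add: sum.cartesian_product del: sum.atMost_Suc)
  also have "{..Suc n} \<times> {..Suc (Suc n)} = A \<union> B"
    by (auto simp: A_def B_def)
  also have "sum G (A \<union> B) = sum G A + sum G B"
    using fin by (intro sum.union_disjoint) (auto simp: A_def B_def)
  also have "sum G A = (\<Sum>p\<in>B. - G p)"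
  proof (rule sum.reindex_bij_witness[where i = "\<lambda>(i, j). (j, Suc i)" and j = "\<lambda>(i, j). (j - 1, i)"])
    fix p assume "p \<in> A"
    then obtain i j where p: "p = (i, j)" "i < j" "j \<le> Suc (Suc n)" by (auto simp: A_def)
    have "formal_extension (face (j - 1) \<circ> face i) c = formal_extension (face i \<circ> face j) c"
    proof (rule formal_extension_cong)
      fix xs assume "c xs \<noteq> 0"
      then have "length xs = Suc (Suc (Suc n))" using c by (auto simp: uf_chains_def)
      then show "(face (j - 1) \<circ> face i) xs = (face i \<circ> face j) xs"
        using face_face[OF _ p(2,3), of xs] by simp
    qed
    moreover have "(- 1) ^ (j - 1 + i) = - ((- 1) ^ (i + j) :: int)"
      using p(2) by (cases j) (simp_all add: add.commute)
    ultimately show "- G (case p of (i, j) \<Rightarrow> (j - 1, i)) = G p"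
      by (simp add: G_def p(1))
  qed (auto simp: A_def B_def)
  finally show "uf_boundary (Suc n) (uf_boundary (Suc (Suc n)) c) ys = 0"
    by (simp add: sum_negf)
qed

lemma uf_boundaries_subset_cycles:
  assumes "UDBG X"
  shows "uf_boundaries X n \<subseteq> uf_cycles X n"
proof
  fix b assume "b \<in> uf_boundaries X n"
  then obtain c where c: "c \<in> uf_chains X (Suc n)" and b: "b = uf_boundary (Suc n) c"
    by (auto simp: uf_boundaries_def)
  have "uf_boundary n b = (\<lambda>_. 0)"
  proof (cases n)
    case (Suc m)
    then show ?thesis using uf_boundary_boundary[OF assms] b c by simp
  qed (simp add: uf_boundary_def)
  then show "b \<in> uf_cycles X n"
    using uf_boundary_in_uf_chains[OF assms c] b by (simp add: uf_cycles_def)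
qed

lemma uf_cycles_0: "uf_cycles X 0 = uf_chains X 0"
  by (auto simp: uf_cycles_def uf_boundary_def)

section \<open>Induced chain maps and the prism homotopy\<close>

lemma map_face: "map f (face j xs) = face j (map f xs)"
  by (simp add: face_def take_map drop_map)

lemma uf_boundary_map:
  assumes X: "UDBG X" and Y: "UDBG Y" and f: "qi_embedding X Y f" and c: "c \<in> uf_chains X (Suc n)"
  shows "uf_boundary (Suc n) (formal_extension (map f) c) = formal_extension (map f) (uf_boundary (Suc n) c)"
proof
  fix ys
  have "formal_extension (map f) (uf_boundary (Suc n) c) ys
      = (\<Sum>j\<le>Suc n. (- 1) ^ j * formal_extension (map f) (formal_extension (face j) c) ys)"
    unfolding uf_boundary_Suc
    by (intro formal_extension_lincomb[OF X controlled_map[OF f, where n = n]])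
      (auto intro: face_chains[OF X c])
  also have "\<dots> = (\<Sum>j\<le>Suc n. (- 1) ^ j * formal_extension (face j) (formal_extension (map f) c) ys)"
  proof (intro sum.cong refl arg_cong[where f = "(*) _"])
    fix j assume "j \<in> {..Suc n}"
    then have j: "j \<le> Suc n" by simp
    have "formal_extension (map f) (formal_extension (face j) c) = formal_extension (map f \<circ> face j) c"
      by (rule formal_extension_comp[OF X controlled_face[OF j] controlled_map[OF f] c])
    also have "map f \<circ> face j = face j \<circ> map f"
      by (simp add: fun_eq_iff map_face)
    also have "formal_extension (face j \<circ> map f) c = formal_extension (face j) (formal_extension (map f) c)"
      by (rule formal_extension_comp[OF X controlled_map[OF f] controlled_face[OF j] c, symmetric])
    finally show "formal_extension (map f) (formal_extension (face j) c) ys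
      = formal_extension (face j) (formal_extension (map f) c) ys" by simp
  qed
  finally show "uf_boundary (Suc n) (formal_extension (map f) c) ys
      = formal_extension (map f) (uf_boundary (Suc n) c) ys"
    by (simp add: uf_boundary_Suc)
qed

lemma formal_extension_zero: "formal_extension \<phi> (\<lambda>_. 0) = (\<lambda>_. 0)"
  by (intro ext) (simp add: formal_extension_def)

lemma map_uf_cycles:
  assumes X: "UDBG X" and Y: "UDBG Y" and f: "qi_embedding X Y f" and c: "c \<in> uf_cycles X n"
  shows "formal_extension (map f) c \<in> uf_cycles Y n"
proof (cases n)
  case 0
  then show ?thesis
    using c formal_extension_in_uf_chains[OF X controlled_map[OF f]] by (simp add: uf_cycles_0)
next
  case (Suc m)
  then show ?thesis
    using c uf_boundary_map[OF X Y f, of c m] formal_extension_in_uf_chains[OF X controlled_map[OF f]]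
    by (simp add: uf_cycles_def formal_extension_zero)
qed

lemma map_uf_boundaries:
  assumes X: "UDBG X" and Y: "UDBG Y" and f: "qi_embedding X Y f" and b: "b \<in> uf_boundaries X n"
  shows "formal_extension (map f) b \<in> uf_boundaries Y n"
proof -
  obtain c where c: "c \<in> uf_chains X (Suc n)" and "b = uf_boundary (Suc n) c"
    using b by (auto simp: uf_boundaries_def)
  then have "formal_extension (map f) b = uf_boundary (Suc n) (formal_extension (map f) c)"
    using uf_boundary_map[OF X Y f] by simp
  then show ?thesis
    using formal_extension_in_uf_chains[OF X controlled_map[OF f] c] by (simp add: uf_boundaries_def)
qed

text \<open>The \<open>i\<close>-th simplex of the triangulated prism over a simplex: it has the vertices \<open>f x\<^sub>0, ..., f x\<^sub>i, f' x\<^sub>i, ..., f' x\<^sub>n\<close>.\<close>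
definition prism :: "('a \<Rightarrow> 'b) \<Rightarrow> ('a \<Rightarrow> 'b) \<Rightarrow> nat \<Rightarrow> 'a list \<Rightarrow> 'b list" where
  "prism f f' i xs = map f (take (Suc i) xs) @ map f' (drop i xs)"

text \<open>The common face of the consecutive prism simplices \<open>i - 1\<close> and \<open>i\<close>; it interpolates from \<open>map f'\<close> at \<open>i = 0\<close> to \<open>map f\<close>.\<close>
definition splice_maps :: "('a \<Rightarrow> 'b) \<Rightarrow> ('a \<Rightarrow> 'b) \<Rightarrow> nat \<Rightarrow> 'a list \<Rightarrow> 'b list" where
  "splice_maps f f' i xs = map f (take i xs) @ map f' (drop i xs)"

lemma length_prism: "i < length xs \<Longrightarrow> length (prism f f' i xs) = Suc (length xs)"
  by (simp add: prism_def)

lemma nth_prism: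
  "i < length xs \<Longrightarrow> k < Suc (length xs) \<Longrightarrow>
     prism f f' i xs ! k = (if k \<le> i then f (xs ! k) else f' (xs ! (k - 1)))"
  by (cases "k \<le> i") (auto simp: prism_def nth_append min_def le_Suc_eq intro!: arg_cong[where f = f'] arg_cong[where f = "(!) xs"])

lemma length_splice_maps: "i \<le> length xs \<Longrightarrow> length (splice_maps f f' i xs) = length xs"
  by (simp add: splice_maps_def)

lemma nth_splice_maps:
  "i \<le> length xs \<Longrightarrow> k < length xs \<Longrightarrow> splice_maps f f' i xs ! k = (if k < i then f (xs ! k) else f' (xs ! k))"
  by (auto simp: splice_maps_def nth_append min_def)

lemma face_prism_less:
  assumes "j < i" "i < length xs"
  shows "face j (prism f f' i xs) = prism f f' (i - 1) (face j xs)"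
  using assms by (intro nth_equalityI) (auto simp: length_face nth_face length_prism nth_prism)

lemma face_prism_eq:
  assumes "i < length xs"
  shows "face i (prism f f' i xs) = splice_maps f f' i xs"
  using assms
  by (intro nth_equalityI) (auto simp: length_face nth_face length_prism nth_prism length_splice_maps nth_splice_maps)

lemma face_prism_Suc:
  assumes "i < length xs"
  shows "face (Suc i) (prism f f' i xs) = splice_maps f f' (Suc i) xs"
  using assms
  by (intro nth_equalityI) (auto simp: length_face nth_face length_prism nth_prism length_splice_maps nth_splice_maps)

lemma face_prism_greater:
  assumes "Suc i < j" "j \<le> length xs"
  shows "face j (prism f f' i xs) = prism f f' i (face (j - 1) xs)"
  using assms by (intro nth_equalityI) (auto simp: length_face nth_face length_prism nth_prism)

lemma controlled_prism:
  assumes f: "qi_embedding X Y f" and f': "f' \<in> X \<rightarrow> Y" and close: "uniformly_close X f f'" and "i \<le> n"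
  shows "controlled X n Y (Suc n) (prism f f' i)"
proof (rule controlled_if_vertices_in_images[OF f f' close])
  fix xs :: "'a list" assume "length xs = Suc n"
  then show "length (prism f f' i xs) = Suc (Suc n) \<and> set (prism f f' i xs) \<subseteq> f ` set xs \<union> f' ` set xs"
    using \<open>i \<le> n\<close> set_take_subset[of "Suc i" xs] set_drop_subset[of i xs]
    by (auto simp: prism_def)
qed

text \<open>In the boundary of the alternating sum of prism simplices the faces \<open>j = i\<close> and \<open>j = i + 1\<close>
telescope to the two ends, and the remaining faces are the prisms over the faces of \<open>c\<close>, which sum to zero for a
cycle.\<close>
lemma prism_homotopy:
  assumes X: "UDBG X" and Y: "UDBG Y" and f: "qi_embedding X Y f" and f': "f' \<in> X \<rightarrow> Y"
    and close: "uniformly_close X f f'" and c: "c \<in> uf_cycles X n"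
  shows "(\<lambda>ys. formal_extension (map f') c ys - formal_extension (map f) c ys) \<in> uf_boundaries Y n"
proof -
  define P where "P = (\<lambda>ys. \<Sum>i\<le>n. (- 1) ^ i * formal_extension (prism f f' i) c ys)"
  have ch: "c \<in> uf_chains X n" and cyc: "uf_boundary n c = (\<lambda>_. 0)"
    using c by (auto simp: uf_cycles_def)
  have len: "length xs = Suc n" if "c xs \<noteq> 0" for xs
    using that ch by (auto simp: uf_chains_def)
  note prism_ctrl = controlled_prism[OF f f' close]
  have prism_ch: "formal_extension (prism f f' i) c \<in> uf_chains Y (Suc n)" if "i \<le> n" for i
    using that by (intro formal_extension_in_uf_chains[OF X prism_ctrl ch])
  have P: "P \<in> uf_chains Y (Suc n)"
    unfolding P_def by (intro uf_chains_lincomb prism_ch) auto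
  have "uf_boundary (Suc n) P ys = formal_extension (map f') c ys - formal_extension (map f) c ys" for ys
  proof -
    define G where "G = (\<lambda>(j, i). (- 1) ^ (j + i) * formal_extension (face j \<circ> prism f f' i) c ys)"
    define H where "H = (\<lambda>(i, j). (- 1) ^ (i + j) * formal_extension (prism f f' i \<circ> face j) c ys)"
    define M where "M i = formal_extension (splice_maps f f' i) c ys" for i
    define A where "A = {(j, i). j < i \<and> i \<le> n}"
    define B where "B = {(j, i). Suc i < j \<and> j \<le> Suc n}"
    define D where "D = (\<lambda>i. (i, i)) ` {..n} \<union> (\<lambda>i. (Suc i, i)) ` {..n}"
    have fin: "finite A" "finite B" "finite D"
      by (rule finite_subset[of _ "{..Suc n} \<times> {..n}"]; auto simp: A_def B_def D_def)+
    have "uf_boundary (Suc n) P ys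
      = (\<Sum>j\<le>Suc n. (- 1) ^ j * (\<Sum>i\<le>n. (- 1) ^ i * formal_extension (face j) (formal_extension (prism f f' i) c) ys))"
      unfolding uf_boundary_Suc P_def
      by (intro sum.cong refl arg_cong[where f = "(*) _"]
          formal_extension_lincomb[OF Y controlled_face]) (auto intro: prism_ch)
    also have "\<dots> = (\<Sum>j\<le>Suc n. \<Sum>i\<le>n. G (j, i))"
      unfolding sum_distrib_left G_def
      by (intro sum.cong refl)
        (simp add: power_add mult.assoc formal_extension_comp[OF X prism_ctrl controlled_face ch])
    also have "\<dots> = sum G ({..Suc n} \<times> {..n})"
      by (simp add: sum.cartesian_product del: sum.atMost_Suc)
    also have "{..Suc n} \<times> {..n} = D \<union> (A \<union> B)"
    proof (intro equalityI subsetI)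
      fix p assume "p \<in> {..Suc n} \<times> {..n}"
      moreover obtain j i where "p = (j, i)" by fastforce
      moreover have "j < i \<or> j = i \<or> j = Suc i \<or> Suc i < j" by linarith
      ultimately show "p \<in> D \<union> (A \<union> B)"
        by (auto simp: A_def B_def D_def)
    qed (auto simp: A_def B_def D_def)
    also have "sum G (D \<union> (A \<union> B)) = sum G D + sum G (A \<union> B)"
      using fin by (intro sum.union_disjoint) (auto simp: A_def B_def D_def)
    also have "sum G D = (\<Sum>i\<le>n. M i) + (\<Sum>i\<le>n. - M (Suc i))"
    proof -
      have "formal_extension (face i \<circ> prism f f' i) c ys = M i"
        "formal_extension (face (Suc i) \<circ> prism f f' i) c ys = M (Suc i)" if "i \<le> n" for i
        unfolding M_def using that len
        by (auto intro!: fun_cong[OF formal_extension_cong] face_prism_eq face_prism_Suc)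
      then have "G (i, i) = M i" "G (Suc i, i) = - M (Suc i)" if "i \<le> n" for i
        using that by (simp_all add: G_def flip: mult_2)
      moreover have "sum G D = sum G ((\<lambda>i. (i, i)) ` {..n}) + sum G ((\<lambda>i. (Suc i, i)) ` {..n})"
        unfolding D_def by (intro sum.union_disjoint) auto
      moreover have "sum G ((\<lambda>i. (i, i)) ` {..n}) = (\<Sum>i\<le>n. G (i, i))"
        "sum G ((\<lambda>i. (Suc i, i)) ` {..n}) = (\<Sum>i\<le>n. G (Suc i, i))"
        by (subst sum.reindex; simp add: inj_on_def)+
      ultimately show ?thesis by simp
    qed
    also have "(\<Sum>i\<le>n. M i) + (\<Sum>i\<le>n. - M (Suc i)) = M 0 - M (Suc n)"
      by (induction n) simp_all
    \<comment> \<open>The faces below and above the diagonal together correspond to the prisms over faces of \<open>c\<close>.\<close>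
    also have "sum G (A \<union> B) = (\<Sum>p\<in>{..<n} \<times> {..n}. - H p)"
    proof (rule sum.reindex_bij_witness[where
          i = "\<lambda>(i, j). if j \<le> i then (j, Suc i) else (Suc j, i)" and
          j = "\<lambda>(j, i). if j < i then (i - 1, j) else (i, j - 1)"])
      fix p assume p: "p \<in> A \<union> B"
      obtain j i where ji: "p = (j, i)" by fastforce
      consider "j < i" "i \<le> n" | "Suc i < j" "j \<le> Suc n"
        using p ji by (auto simp: A_def B_def)
      then show "- H (case p of (j, i) \<Rightarrow> if j < i then (i - 1, j) else (i, j - 1)) = G p"
      proof cases
        case 1
        have "formal_extension (face j \<circ> prism f f' i) c = formal_extension (prism f f' (i - 1) \<circ> face j) c"
          using 1 len by (intro formal_extension_cong) (simp add: face_prism_less)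
        moreover have "(- 1) ^ (i - 1 + j) = - ((- 1) ^ (j + i) :: int)"
          using 1 by (cases i) (simp_all add: add.commute)
        ultimately show ?thesis using 1 by (simp add: H_def G_def ji)
      next
        case 2
        have "formal_extension (face j \<circ> prism f f' i) c = formal_extension (prism f f' i \<circ> face (j - 1)) c"
          using 2 len by (intro formal_extension_cong) (simp add: face_prism_greater)
        moreover have "(- 1) ^ (i + (j - 1)) = - ((- 1) ^ (j + i) :: int)"
          using 2 by (cases j) (simp_all add: add.commute)
        ultimately show ?thesis using 2 by (simp add: H_def G_def ji)
      qed
    qed (auto simp: A_def B_def split: if_splits)
    also have "\<dots> = - (\<Sum>i<n. \<Sum>j\<le>n. H (i, j))"
      by (simp add: sum_negf sum.cartesian_product)
    also have "(\<Sum>i<n. \<Sum>j\<le>n. H (i, j)) = 0"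
    proof (rule sum.neutral, rule ballI)
      fix i assume i: "i \<in> {..<n}"
      then obtain m where n: "n = Suc m" and im: "i \<le> m" by (cases n) auto
      have "(\<Sum>j\<le>n. H (i, j)) = (- 1) ^ i * (\<Sum>j\<le>Suc m. (- 1) ^ j * formal_extension (prism f f' i) (formal_extension (face j) c) ys)"
        unfolding H_def sum_distrib_left n
        by (intro sum.cong refl)
          (simp add: power_add mult.assoc formal_extension_comp[OF X controlled_face prism_ctrl[OF im] ch[unfolded n]])
      also have "(\<Sum>j\<le>Suc m. (- 1) ^ j * formal_extension (prism f f' i) (formal_extension (face j) c) ys)
          = formal_extension (prism f f' i) (uf_boundary n c) ys"
        unfolding n uf_boundary_Suc
        by (intro formal_extension_lincomb[OF X prism_ctrl[OF im], symmetric])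
          (auto intro: face_chains[OF X ch[unfolded n]])
      also have "\<dots> = 0"
        by (simp add: cyc formal_extension_zero)
      finally show "(\<Sum>j\<le>n. H (i, j)) = 0" by simp
    qed
    finally have "uf_boundary (Suc n) P ys = M 0 - M (Suc n)" by simp
    moreover have "M 0 = formal_extension (map f') c ys" "M (Suc n) = formal_extension (map f) c ys"
      unfolding M_def using len
      by (auto intro!: fun_cong[OF formal_extension_cong] simp: splice_maps_def)
    ultimately show ?thesis by simp
  qed
  then have "(\<lambda>ys. formal_extension (map f') c ys - formal_extension (map f) c ys) = uf_boundary (Suc n) P"
    by auto
  then show ?thesis using P by (simp add: uf_boundaries_def)
qed

section \<open>Homology groups as cosets of cycles\<close>

lemma uf_cycle_group_simps:
  "carrier (uf_cycle_group X n) = uf_cycles X n"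
  "c \<otimes>\<^bsub>uf_cycle_group X n\<^esub> d = (\<lambda>xs. c xs + d xs)"
  "\<one>\<^bsub>uf_cycle_group X n\<^esub> = (\<lambda>_. 0)"
  by (simp_all add: uf_cycle_group_def)

lemma uf_cycles_add:
  assumes "UDBG X" "c \<in> uf_cycles X n" "d \<in> uf_cycles X n"
  shows "(\<lambda>xs. c xs + d xs) \<in> uf_cycles X n"
  using assms by (simp add: uf_cycles_def uf_chains_add uf_boundary_add)

lemma uf_cycles_uminus: "c \<in> uf_cycles X n \<Longrightarrow> (\<lambda>xs. - c xs) \<in> uf_cycles X n"
  by (simp add: uf_cycles_def uf_chains_uminus uf_boundary_uminus)

lemma uf_boundary_zero: "uf_boundary n (\<lambda>_. 0) = (\<lambda>_. 0)"
  by (simp add: uf_boundary_def formal_extension_zero)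

lemma comm_group_uf_cycle_group:
  assumes "UDBG X"
  shows "comm_group (uf_cycle_group X n)"
proof (rule comm_groupI)
  fix c assume "c \<in> carrier (uf_cycle_group X n)"
  then show "\<exists>d\<in>carrier (uf_cycle_group X n). d \<otimes>\<^bsub>uf_cycle_group X n\<^esub> c = \<one>\<^bsub>uf_cycle_group X n\<^esub>"
    by (intro bexI[of _ "\<lambda>xs. - c xs"]) (simp_all add: uf_cycle_group_simps uf_cycles_uminus)
next
  show "\<one>\<^bsub>uf_cycle_group X n\<^esub> \<in> carrier (uf_cycle_group X n)"
    by (simp add: uf_cycle_group_simps uf_cycles_def uf_chains_zero uf_boundary_zero)
qed (simp_all add: uf_cycle_group_simps uf_cycles_add[OF assms] algebra_simps)

lemma uf_cycle_group_inv:
  assumes "UDBG X" "c \<in> uf_cycles X n"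
  shows "inv\<^bsub>uf_cycle_group X n\<^esub> c = (\<lambda>xs. - c xs)"
proof -
  interpret comm_group "uf_cycle_group X n" by (rule comm_group_uf_cycle_group[OF assms(1)])
  show ?thesis
    using assms by (intro inv_equality) (simp_all add: uf_cycle_group_simps uf_cycles_uminus)
qed

lemma subgroup_uf_boundaries:
  assumes X: "UDBG X"
  shows "subgroup (uf_boundaries X n) (uf_cycle_group X n)"
proof
  show sub: "uf_boundaries X n \<subseteq> carrier (uf_cycle_group X n)"
    using uf_boundaries_subset_cycles[OF X] by (simp add: uf_cycle_group_simps)
  show "\<one>\<^bsub>uf_cycle_group X n\<^esub> \<in> uf_boundaries X n"
    unfolding uf_boundaries_def uf_cycle_group_simps
    by (rule image_eqI[OF _ uf_chains_zero]) (simp add: uf_boundary_zero)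
  fix b assume b: "b \<in> uf_boundaries X n"
  then obtain c where c: "c \<in> uf_chains X (Suc n)" "b = uf_boundary (Suc n) c"
    by (auto simp: uf_boundaries_def)
  have "b \<in> uf_cycles X n" using b uf_boundaries_subset_cycles[OF X] by blast
  then show "inv\<^bsub>uf_cycle_group X n\<^esub> b \<in> uf_boundaries X n"
    unfolding uf_boundaries_def uf_cycle_group_inv[OF X \<open>b \<in> uf_cycles X n\<close>]
    by (intro image_eqI[OF _ uf_chains_uminus[OF c(1)]]) (simp add: uf_boundary_uminus c(2))
  fix b' assume "b' \<in> uf_boundaries X n"
  then obtain c' where c': "c' \<in> uf_chains X (Suc n)" "b' = uf_boundary (Suc n) c'"
    by (auto simp: uf_boundaries_def)
  show "b \<otimes>\<^bsub>uf_cycle_group X n\<^esub> b' \<in> uf_boundaries X n"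
    unfolding uf_boundaries_def uf_cycle_group_simps
    by (rule image_eqI[OF _ uf_chains_add[OF c(1) c'(1)]])
      (simp add: uf_boundary_add[OF X c(1) c'(1)] c(2) c'(2))
qed

abbreviation uf_class :: "'a::metric_space set \<Rightarrow> nat \<Rightarrow> ('a list \<Rightarrow> int) \<Rightarrow> ('a list \<Rightarrow> int) set" where
  "uf_class X n c \<equiv> uf_boundaries X n #>\<^bsub>uf_cycle_group X n\<^esub> c"

lemma mem_uf_class_iff:
  "d \<in> uf_class X n c \<longleftrightarrow> (\<lambda>xs. d xs - c xs) \<in> uf_boundaries X n"
proof
  assume "(\<lambda>xs. d xs - c xs) \<in> uf_boundaries X n"
  then show "d \<in> uf_class X n c"
    unfolding r_coset_def uf_cycle_group_simps
    by (auto intro!: bexI[of _ "\<lambda>xs. d xs - c xs"])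
qed (auto simp: r_coset_def uf_cycle_group_simps)

lemma self_mem_uf_class: "UDBG X \<Longrightarrow> c \<in> uf_class X n c"
  unfolding mem_uf_class_iff
  using subgroup.one_closed[OF subgroup_uf_boundaries] by (simp add: uf_cycle_group_simps)

lemma uf_class_eq:
  assumes X: "UDBG X" and "c \<in> uf_cycles X n" "d \<in> uf_class X n c"
  shows "uf_class X n d = uf_class X n c"
proof -
  interpret comm_group "uf_cycle_group X n" by (rule comm_group_uf_cycle_group[OF X])
  show ?thesis
    using repr_independence[OF assms(3) _ subgroup_uf_boundaries[OF X]] assms(2)
    by (simp add: uf_cycle_group_simps)
qed

lemma carrier_uf_homology: "carrier (uf_homology X n) = uf_class X n ` uf_cycles X n"
  by (auto simp: uf_homology_def FactGroup_def RCOSETS_def uf_cycle_group_simps)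

lemma uf_class_subset_cycles:
  assumes X: "UDBG X" and "c \<in> uf_cycles X n"
  shows "uf_class X n c \<subseteq> uf_cycles X n"
  using uf_cycles_add[OF X _ assms(2)] uf_boundaries_subset_cycles[OF X]
  by (auto simp: r_coset_def uf_cycle_group_simps)

lemma uf_homology_map_class:
  assumes X: "UDBG X" and Y: "UDBG Y" and f: "qi_embedding X Y f" and c: "c \<in> uf_cycles X n"
  shows "uf_homology_map Y n f (uf_class X n c) = uf_class Y n (formal_extension (map f) c)"
proof -
  have "uf_class Y n (formal_extension (map f) d) = uf_class Y n (formal_extension (map f) c)"
    if d: "d \<in> uf_class X n c" for d
  proof (rule uf_class_eq[OF Y map_uf_cycles[OF X Y f c]])
    have cyc: "c \<in> uf_chains X n" "d \<in> uf_chains X n"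
      using c d uf_class_subset_cycles[OF X c] by (auto simp: uf_cycles_def)
    have "(\<lambda>ys. formal_extension (map f) d ys - formal_extension (map f) c ys)
        = formal_extension (map f) (\<lambda>xs. d xs + - c xs)"
      unfolding formal_extension_add[OF X controlled_map[OF f] cyc(2) uf_chains_uminus[OF cyc(1)]]
      by (simp add: formal_extension_uminus)
    then show "formal_extension (map f) d \<in> uf_class Y n (formal_extension (map f) c)"
      using map_uf_boundaries[OF X Y f] d by (simp add: mem_uf_class_iff)
  qed
  then have "(\<lambda>d. uf_class Y n (formal_extension (map f) d)) ` uf_class X n c
      = (\<lambda>_. uf_class Y n (formal_extension (map f) c)) ` uf_class X n c"
    by (intro image_cong refl)
  also have "\<dots> = {uf_class Y n (formal_extension (map f) c)}"
    using self_mem_uf_class[OF X, of c n] by (intro image_constant)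
  finally show ?thesis
    unfolding uf_homology_map_def by simp
qed

lemma uf_homology_map_close:
  assumes X: "UDBG X" and Y: "UDBG Y" and f: "qi_embedding X Y f" and f': "qi_embedding X Y f'"
    and close: "uniformly_close X f f'" and \<alpha>: "\<alpha> \<in> carrier (uf_homology X n)"
  shows "uf_homology_map Y n f \<alpha> = uf_homology_map Y n f' \<alpha>"
proof -
  obtain c where c: "c \<in> uf_cycles X n" "\<alpha> = uf_class X n c"
    using \<alpha> by (auto simp: carrier_uf_homology)
  have "f' \<in> X \<rightarrow> Y" using f' by (simp add: qi_embedding_def)
  then have "formal_extension (map f') c \<in> uf_class Y n (formal_extension (map f) c)"
    unfolding mem_uf_class_iff by (intro prism_homotopy[OF X Y f _ close c(1)])
  then show ?thesis
    unfolding c(2) uf_homology_map_class[OF X Y f c(1)] uf_homology_map_class[OF X Y f' c(1)]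
    by (rule uf_class_eq[OF Y map_uf_cycles[OF X Y f c(1)], symmetric])
qed

lemma uf_norm_upper:
  assumes "c \<in> uf_chains X n"
  shows "real_of_int \<bar>c xs\<bar> \<le> uf_norm c"
proof -
  obtain B where B: "\<And>xs. \<bar>c xs\<bar> \<le> B" using uf_chainsE[OF assms] by metis
  have "bdd_above (range (\<lambda>xs. real_of_int \<bar>c xs\<bar>))"
    unfolding bdd_above_def using B by (intro exI[of _ "real_of_int B"]) (auto simp only: of_int_le_iff)
  then show ?thesis unfolding uf_norm_def by (rule cSUP_upper[OF UNIV_I])
qed

lemma uf_norm_nonneg: "c \<in> uf_chains X n \<Longrightarrow> 0 \<le> uf_norm c"
  using uf_norm_upper[of c X n undefined] by linarith

context
  fixes X :: "'a::metric_space set" and Y :: "'b::metric_space set" and f g and n :: nat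
  assumes X: "UDBG X" and Y: "UDBG Y"
    and f: "qi_embedding X Y f" and g: "qi_embedding Y X g"
    and gf: "\<forall>x\<in>X. g (f x) = x"
begin

lemma map_map_inverse: "set xs \<subseteq> X \<Longrightarrow> map g (map f xs) = xs"
  using gf by (induction xs) auto

lemma map_inverse_chain:
  assumes c: "c \<in> uf_chains X n"
  shows "formal_extension (map g) (formal_extension (map f) c) = c"
proof -
  have "formal_extension (map g) (formal_extension (map f) c) = formal_extension (map g \<circ> map f) c"
    by (rule formal_extension_comp[OF X controlled_map[OF f] controlled_map[OF g] c])
  also have "\<dots> = formal_extension id c"
  proof (rule formal_extension_cong)
    fix xs assume "c xs \<noteq> 0"
    then have "set xs \<subseteq> X" using c by (auto simp: uf_chains_def)
    then show "(map g \<circ> map f) xs = id xs"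
      using map_map_inverse[of xs] by simp
  qed
  finally show ?thesis by (simp add: formal_extension_id)
qed

text \<open>An injective map moves each coefficient to a different tuple, so no coefficients are added up.\<close>
lemma uf_norm_map_le:
  assumes c: "c \<in> uf_chains X n"
  shows "uf_norm (formal_extension (map f) c) \<le> uf_norm c"
proof -
  have "real_of_int \<bar>formal_extension (map f) c ys\<bar> \<le> uf_norm c" for ys
  proof -
    have "formal_extension (map f) c ys = 0 \<or> (\<exists>xs. formal_extension (map f) c ys = c xs)"
    proof (cases "formal_extension (map f) c ys = 0")
      case False
      then obtain xs where xs: "c xs \<noteq> 0" "map f xs = ys"
        by (rule formal_extension_nonzeroE)
      have "zs = xs" if "c zs \<noteq> 0" "map f zs = ys" for zs
      proof -
        have "set zs \<subseteq> X" "set xs \<subseteq> X" using that xs c by (auto simp: uf_chains_def)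
        moreover have "map g (map f zs) = map g (map f xs)" using that xs by simp
        ultimately show ?thesis
          using map_map_inverse by metis
      qed
      then have "formal_extension (map f) c ys = sum c {xs}"
        using xs by (intro formal_extension_eq_sum) blast+
      then show ?thesis by auto
    qed simp
    then show ?thesis
    proof (elim disjE exE)
      assume "formal_extension (map f) c ys = 0"
      then show ?thesis using uf_norm_nonneg[OF c] by simp
    next
      fix xs assume "formal_extension (map f) c ys = c xs"
      then show ?thesis using uf_norm_upper[OF c, of xs] by simp
    qed
  qed
  then show ?thesis
    by (subst uf_norm_def) (rule cSUP_least; simp)
qed

end

text \<open>A map with an inverse carries each class, as a set of cycles, bijectively and norm-preservingly onto its image
class; the infima that define the two seminorms are then taken over the same set of norms.\<close>
lemma uf_isometric_iso_of_inverse: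
  assumes X: "UDBG X" and Y: "UDBG Y" and f: "qi_embedding X Y f" and g: "qi_embedding Y X g"
    and gf: "\<forall>x\<in>X. g (f x) = x" and fg: "\<forall>y\<in>Y. f (g y) = y"
  shows "uf_isometric_iso X Y n f"
proof -
  let ?F = "formal_extension (map f)" and ?G = "formal_extension (map g)"
  note GF = map_inverse_chain[OF X Y f g gf, where n = n]
  note FG = map_inverse_chain[OF Y X g f fg, where n = n]
  have ch: "c \<in> uf_chains X n" if "c \<in> uf_cycles X n" for c using that by (simp add: uf_cycles_def)
  have map_class: "uf_homology_map Y n f (uf_class X n c) = ?F ` uf_class X n c" if c: "c \<in> uf_cycles X n" for c
  proof -
    have "?F ` uf_class X n c = uf_class Y n (?F c)"
    proof (intro equalityI subsetI)
      fix e assume "e \<in> ?F ` uf_class X n c"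
      then obtain b where b: "b \<in> uf_boundaries X n" "e = ?F (\<lambda>xs. b xs + c xs)"
        by (auto simp: r_coset_def uf_cycle_group_simps)
      have "b \<in> uf_chains X n"
        using b uf_boundaries_subset_cycles[OF X] ch by blast
      then have "e = (\<lambda>ys. ?F b ys + ?F c ys)"
        unfolding b(2) by (rule formal_extension_add[OF X controlled_map[OF f] _ ch[OF c]])
      then show "e \<in> uf_class Y n (?F c)"
        using map_uf_boundaries[OF X Y f b(1)] by (simp add: mem_uf_class_iff)
    next
      fix e assume e: "e \<in> uf_class Y n (?F c)"
      then obtain b where b: "b \<in> uf_boundaries Y n" "e = (\<lambda>xs. b xs + ?F c xs)"
        by (auto simp: r_coset_def uf_cycle_group_simps)
      have "b \<in> uf_cycles Y n" using b uf_boundaries_subset_cycles[OF Y] by blast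
      then have bch: "b \<in> uf_chains Y n" by (simp add: uf_cycles_def)
      have Fc: "?F c \<in> uf_chains Y n"
        using map_uf_cycles[OF X Y f c] by (simp add: uf_cycles_def)
      have "?G e = (\<lambda>xs. ?G b xs + c xs)"
        unfolding b(2) formal_extension_add[OF Y controlled_map[OF g] bch Fc] GF[OF ch[OF c]] ..
      then have "?G e \<in> uf_class X n c"
        using map_uf_boundaries[OF Y X g b(1)] by (simp add: mem_uf_class_iff)
      moreover have "?F (?G e) = e"
        using FG uf_chains_add[OF bch Fc] b(2) by simp
      ultimately show "e \<in> ?F ` uf_class X n c" by (metis imageI)
    qed
    then show ?thesis by (simp add: uf_homology_map_class[OF X Y f c])
  qed
  have class_chains: "uf_class X n c \<subseteq> uf_chains X n" if "c \<in> uf_cycles X n" for c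
    using uf_class_subset_cycles[OF X that] ch by blast
  have hom: "uf_homology_map Y n f \<in> hom (uf_homology X n) (uf_homology Y n)"
  proof (rule homI)
    fix \<alpha> assume "\<alpha> \<in> carrier (uf_homology X n)"
    then obtain c where c: "c \<in> uf_cycles X n" "\<alpha> = uf_class X n c"
      by (auto simp: carrier_uf_homology)
    then show "uf_homology_map Y n f \<alpha> \<in> carrier (uf_homology Y n)"
      using map_uf_cycles[OF X Y f c(1)] by (simp add: uf_homology_map_class[OF X Y f] carrier_uf_homology)
    fix \<beta> assume "\<beta> \<in> carrier (uf_homology X n)"
    then obtain d where d: "d \<in> uf_cycles X n" "\<beta> = uf_class X n d"
      by (auto simp: carrier_uf_homology)
    interpret GX: comm_group "uf_cycle_group X n" by (rule comm_group_uf_cycle_group[OF X])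
    interpret GY: comm_group "uf_cycle_group Y n" by (rule comm_group_uf_cycle_group[OF Y])
    interpret NX: normal "uf_boundaries X n" "uf_cycle_group X n"
      by (rule GX.subgroup_imp_normal[OF subgroup_uf_boundaries[OF X]])
    interpret NY: normal "uf_boundaries Y n" "uf_cycle_group Y n"
      by (rule GY.subgroup_imp_normal[OF subgroup_uf_boundaries[OF Y]])
    have sumX: "\<alpha> \<otimes>\<^bsub>uf_homology X n\<^esub> \<beta> = uf_class X n (\<lambda>xs. c xs + d xs)"
      using NX.rcos_sum[of c d] c d by (simp add: uf_homology_def FactGroup_def uf_cycle_group_simps)
    have sumY: "uf_class Y n (?F c) \<otimes>\<^bsub>uf_homology Y n\<^esub> uf_class Y n (?F d) = uf_class Y n (\<lambda>xs. ?F c xs + ?F d xs)"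
      using NY.rcos_sum[of "?F c" "?F d"] map_uf_cycles[OF X Y f c(1)] map_uf_cycles[OF X Y f d(1)]
      by (simp add: uf_homology_def FactGroup_def uf_cycle_group_simps)
    show "uf_homology_map Y n f (\<alpha> \<otimes>\<^bsub>uf_homology X n\<^esub> \<beta>)
        = uf_homology_map Y n f \<alpha> \<otimes>\<^bsub>uf_homology Y n\<^esub> uf_homology_map Y n f \<beta>"
      unfolding sumX unfolding c(2) d(2)
      by (simp add: uf_homology_map_class[OF X Y f] c d uf_cycles_add[OF X] sumY
          formal_extension_add[OF X controlled_map[OF f] ch[OF c(1)] ch[OF d(1)]])
  qed
  have "inj_on (uf_homology_map Y n f) (carrier (uf_homology X n))"
  proof (rule inj_onI)
    fix \<alpha> \<beta> assume "\<alpha> \<in> carrier (uf_homology X n)" "\<beta> \<in> carrier (uf_homology X n)"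
      and eq: "uf_homology_map Y n f \<alpha> = uf_homology_map Y n f \<beta>"
    then obtain c d where c: "c \<in> uf_cycles X n" "\<alpha> = uf_class X n c"
      and d: "d \<in> uf_cycles X n" "\<beta> = uf_class X n d"
      by (auto simp: carrier_uf_homology)
    have images: "?F ` \<alpha> = ?F ` \<beta>" using eq c d by (simp add: map_class)
    have round_trip: "?G ` ?F ` uf_class X n e = uf_class X n e" if "e \<in> uf_cycles X n" for e
    proof -
      have "(\<lambda>b. ?G (?F b)) ` uf_class X n e = (\<lambda>b. b) ` uf_class X n e"
        using class_chains[OF that] by (intro image_cong refl GF) blast
      then show ?thesis by (simp add: image_image)
    qed
    have "\<alpha> = ?G ` ?F ` \<alpha>" unfolding c(2) round_trip[OF c(1)] ..
    also have "\<dots> = ?G ` ?F ` \<beta>" unfolding images ..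
    also have "\<dots> = \<beta>" unfolding d(2) round_trip[OF d(1)] ..
    finally show "\<alpha> = \<beta>" .
  qed
  moreover have "uf_homology_map Y n f ` carrier (uf_homology X n) = carrier (uf_homology Y n)"
  proof (intro equalityI subsetI)
    fix \<beta> assume "\<beta> \<in> carrier (uf_homology Y n)"
    then obtain d where d: "d \<in> uf_cycles Y n" "\<beta> = uf_class Y n d"
      by (auto simp: carrier_uf_homology)
    have "?G d \<in> uf_cycles X n" by (rule map_uf_cycles[OF Y X g d(1)])
    moreover have "?F (?G d) = d" using d(1) by (intro FG) (simp add: uf_cycles_def)
    ultimately have "uf_homology_map Y n f (uf_class X n (?G d)) = \<beta>"
      using d(2) by (simp add: uf_homology_map_class[OF X Y f])
    then show "\<beta> \<in> uf_homology_map Y n f ` carrier (uf_homology X n)"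
      using \<open>?G d \<in> uf_cycles X n\<close> by (auto simp: carrier_uf_homology)
  qed (use hom in \<open>auto simp: hom_def\<close>)
  ultimately have iso: "uf_homology_map Y n f \<in> iso (uf_homology X n) (uf_homology Y n)"
    using hom by (simp add: iso_def bij_betw_def)
  have norm: "uf_norm (?F c) = uf_norm c" if c: "c \<in> uf_chains X n" for c
  proof (rule antisym)
    show "uf_norm (?F c) \<le> uf_norm c" by (rule uf_norm_map_le[OF X Y f g gf c])
    have "uf_norm (?G (?F c)) \<le> uf_norm (?F c)"
      using formal_extension_in_uf_chains[OF X controlled_map[OF f] c]
      by (rule uf_norm_map_le[OF Y X g f fg])
    then show "uf_norm c \<le> uf_norm (?F c)" by (simp add: GF c)
  qed
  have "uf_seminorm (uf_homology_map Y n f \<alpha>) = uf_seminorm \<alpha>"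
    if \<alpha>: "\<alpha> \<in> carrier (uf_homology X n)" for \<alpha>
  proof -
    obtain c where c: "c \<in> uf_cycles X n" "\<alpha> = uf_class X n c"
      using \<alpha> by (auto simp: carrier_uf_homology)
    have "uf_norm ` ?F ` \<alpha> = uf_norm ` \<alpha>"
      unfolding image_image c(2) using class_chains[OF c(1)] by (intro image_cong refl norm) blast
    then show ?thesis
      unfolding uf_seminorm_def c(2) map_class[OF c(1)] by simp
  qed
  with iso show ?thesis by (simp add: uf_isometric_iso_def)
qed

lemma uf_isometric_iso_close:
  assumes X: "UDBG X" and Y: "UDBG Y" and f: "qi_embedding X Y f" and f': "qi_embedding X Y f'"
    and close: "uniformly_close X f f'" and iso': "uf_isometric_iso X Y n f'"
  shows "uf_isometric_iso X Y n f"
proof -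
  interpret comm_group "uf_cycle_group X n" by (rule comm_group_uf_cycle_group[OF X])
  interpret normal "uf_boundaries X n" "uf_cycle_group X n"
    by (rule subgroup_imp_normal[OF subgroup_uf_boundaries[OF X]])
  have G: "group (uf_homology X n)"
    unfolding uf_homology_def by (rule factorgroup_is_group)
  note eq = uf_homology_map_close[OF X Y f f' close, of _ n]
  have "uf_homology_map Y n f \<in> iso (uf_homology X n) (uf_homology Y n)"
    using group.iso_eq[OF G] iso' eq unfolding uf_isometric_iso_def by blast
  then show ?thesis
    using iso' eq by (simp add: uf_isometric_iso_def)
qed

lemma bilipschitz_embedding_imp_qi_embedding:
  assumes "bilipschitz_embedding X Y f"
  shows "qi_embedding X Y f"
proof -
  have "f \<in> X \<rightarrow> Y"
    using assms by (simp add: bilipschitz_embedding_def)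
  obtain C where "C > 0" and C: "\<forall>x\<in>X. \<forall>x'\<in>X.
        1 / C * dist x x' \<le> dist (f x) (f x') \<and> dist (f x) (f x') \<le> C * dist x x'"
    using assms unfolding bilipschitz_embedding_def by (elim conjE exE) (rule that)
  have "\<forall>x\<in>X. \<forall>x'\<in>X.
      1 / C * dist x x' - 1 \<le> dist (f x) (f x') \<and> dist (f x) (f x') \<le> C * dist x x' + 1"
  proof (intro ballI)
    fix x x' assume "x \<in> X" "x' \<in> X"
    then have "1 / C * dist x x' \<le> dist (f x) (f x') \<and> dist (f x) (f x') \<le> C * dist x x'"
      using C by blast
    then show "1 / C * dist x x' - 1 \<le> dist (f x) (f x') \<and> dist (f x) (f x') \<le> C * dist x x' + 1"
      by linarith
  qed
  with \<open>C > 0\<close> show ?thesis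
    unfolding qi_embedding_def
    by (intro conjI \<open>f \<in> X \<rightarrow> Y\<close> exI[of _ C] exI[of _ "1 :: real"] zero_less_one)
qed

lemma close_to_bilipschitz_imp_isometric_iso:
  assumes X: "UDBG X" and Y: "UDBG Y" and f: "qi_embedding X Y f"
    and f': "bilipschitz_equivalence X Y f'" and close: "uniformly_close X f f'"
  shows "uf_isometric_iso X Y n f"
proof -
  obtain g where g: "bilipschitz_embedding Y X g" "\<forall>x\<in>X. g (f' x) = x" "\<forall>y\<in>Y. f' (g y) = y"
    using f' by (auto simp: bilipschitz_equivalence_def)
  have f'qi: "qi_embedding X Y f'"
    using f' by (simp add: bilipschitz_equivalence_def bilipschitz_embedding_imp_qi_embedding)
  have "uf_isometric_iso X Y n f'"
    by (rule uf_isometric_iso_of_inverse[OF X Y f'qi bilipschitz_embedding_imp_qi_embedding[OF g(1)] g(2,3)])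
  then show ?thesis
    by (rule uf_isometric_iso_close[OF X Y f f'qi close])
qed

section \<open>Zero-dimensional boundaries as flows\<close>

lemma UDBG_bounded_geometry:
  assumes "UDBG X"
  obtains K where "\<And>x. x \<in> X \<Longrightarrow> finite {y\<in>X. dist x y \<le> r} \<and> card {y\<in>X. dist x y \<le> r} \<le> K"
proof -
  have "\<bar>r\<bar> + 1 > 0" by simp
  then obtain K where K: "\<And>x. x \<in> X \<Longrightarrow> finite (X \<inter> ball x (\<bar>r\<bar> + 1)) \<and> card (X \<inter> ball x (\<bar>r\<bar> + 1)) < K"
    using assms unfolding UDBG_def by blast
  have sub: "{y\<in>X. dist x y \<le> r} \<subseteq> X \<inter> ball x (\<bar>r\<bar> + 1)" for x
    by auto
  show ?thesis
  proof (rule that[of K])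
    fix x assume "x \<in> X"
    then have fin: "finite (X \<inter> ball x (\<bar>r\<bar> + 1))" and "card (X \<inter> ball x (\<bar>r\<bar> + 1)) \<le> K"
      using K[of x] by auto
    then show "finite {y\<in>X. dist x y \<le> r} \<and> card {y\<in>X. dist x y \<le> r} \<le> K"
      using finite_subset[OF sub[of x] fin] card_mono[OF fin sub[of x]] by linarith
  qed
qed

definition outer_boundary :: "'a::metric_space set \<Rightarrow> real \<Rightarrow> 'a set \<Rightarrow> 'a set" where
  "outer_boundary Y r S = {a \<in> Y - S. \<exists>y\<in>S. dist y a \<le> r}"

lemma outer_boundary_mono: "r \<le> s \<Longrightarrow> outer_boundary Y r S \<subseteq> outer_boundary Y s S"
  by (force simp: outer_boundary_def)

lemma finite_outer_boundary:
  assumes "UDBG Y" "finite S" "S \<subseteq> Y"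
  shows "finite (outer_boundary Y r S)"
proof -
  obtain K where K: "\<And>x. x \<in> Y \<Longrightarrow> finite {y\<in>Y. dist x y \<le> r} \<and> card {y\<in>Y. dist x y \<le> r} \<le> K"
    using UDBG_bounded_geometry[OF assms(1), of r] by blast
  show ?thesis
  proof (rule finite_subset)
    show "outer_boundary Y r S \<subseteq> (\<Union>s\<in>S. {y\<in>Y. dist s y \<le> r})"
      by (auto simp: outer_boundary_def)
    show "finite (\<Union>s\<in>S. {y\<in>Y. dist s y \<le> r})"
      using assms(2,3) K by blast
  qed
qed

text \<open>A \<open>1\<close>-chain is a flow along edges. In the sum of its boundary over \<open>S\<close> the edges inside \<open>S\<close> cancel, and only those
that join \<open>S\<close> to its outer boundary remain. Each outer point lies on a bounded number of edges, each with a bounded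
coefficient.\<close>
lemma boundary_flow_bound:
  assumes Y: "UDBG Y" and b: "b \<in> uf_chains Y (Suc 0)"
  obtains D :: nat and r where "\<And>S. S \<subseteq> Y \<Longrightarrow> finite S \<Longrightarrow>
    \<bar>\<Sum>y\<in>S. uf_boundary (Suc 0) b [y]\<bar> \<le> int (D * card (outer_boundary Y r S))"
proof -
  obtain B r where B: "\<And>xs. \<bar>b xs\<bar> \<le> B" and r: "\<And>xs. b xs \<noteq> 0 \<Longrightarrow> xs \<in> tuples Y (Suc 0) r"
    using uf_chainsE[OF b] by metis
  obtain K where K: "\<And>x. x \<in> Y \<Longrightarrow> finite {y\<in>Y. dist x y \<le> r} \<and> card {y\<in>Y. dist x y \<le> r} \<le> K"
    using UDBG_bounded_geometry[OF Y, of r] by blast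
  have "B \<ge> 0" using B[of undefined] by linarith
  have edge: "x \<in> Y \<and> y \<in> Y \<and> dist x y \<le> r" if "b [x, y] \<noteq> 0" for x y
    using r[OF that] by (simp add: tuples_def)
  have "\<bar>\<Sum>y\<in>S. uf_boundary (Suc 0) b [y]\<bar> \<le> int (nat (2 * B * int K) * card (outer_boundary Y r S))"
    if S: "S \<subseteq> Y" "finite S" for S
  proof -
    define A where "A = outer_boundary Y r S"
    have A: "finite A" "A \<subseteq> Y" "S \<inter> A = {}"
      using finite_outer_boundary[OF Y S(2,1), of r] by (auto simp: A_def outer_boundary_def)
    \<comment> \<open>The net flow from \<open>a\<close> to \<open>y\<close>.\<close>
    define w where "w y a = b [a, y] - b [y, a]" for y a
    have w_le: "\<bar>w y a\<bar> \<le> 2 * B" for y a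
      unfolding w_def using B[of "[a, y]"] B[of "[y, a]"] by linarith
    have "uf_boundary (Suc 0) b [y] = (\<Sum>a\<in>S \<union> A. w y a)" if "y \<in> S" for y
    proof -
      have pair: "\<exists>a0 a1. xs = [a0, a1]" if "b xs \<noteq> 0" for xs
        using r[OF that] by (auto simp: tuples_def length_Suc_conv)
      have near: "a \<in> S \<union> A" if "b [a, y] \<noteq> 0 \<or> b [y, a] \<noteq> 0" for a
      proof -
        have "a \<in> Y \<and> dist y a \<le> r"
          using that edge[of a y] edge[of y a] dist_commute[of a y] by auto
        then show ?thesis using \<open>y \<in> S\<close> by (auto simp: A_def outer_boundary_def)
      qed
      have "formal_extension (face 0) b [y] = sum b ((\<lambda>a. [a, y]) ` (S \<union> A))"
      proof (rule formal_extension_eq_sum)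
        fix xs assume xs: "b xs \<noteq> 0" "face 0 xs = [y]"
        then obtain a where "xs = [a, y]" using pair[of xs] by (auto simp: face_def)
        then show "xs \<in> (\<lambda>a. [a, y]) ` (S \<union> A)" using xs near by auto
      qed (use S A in \<open>auto simp: face_def\<close>)
      moreover have "formal_extension (face 1) b [y] = sum b ((\<lambda>a. [y, a]) ` (S \<union> A))"
      proof (rule formal_extension_eq_sum)
        fix xs assume xs: "b xs \<noteq> 0" "face 1 xs = [y]"
        then obtain a where "xs = [y, a]" using pair[of xs] by (auto simp: face_def)
        then show "xs \<in> (\<lambda>a. [y, a]) ` (S \<union> A)" using xs near by auto
      qed (use S A in \<open>auto simp: face_def\<close>)
      ultimately show ?thesis
        by (simp add: uf_boundary_def w_def sum_subtractf sum.reindex inj_on_def)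
    qed
    then have "(\<Sum>y\<in>S. uf_boundary (Suc 0) b [y]) = (\<Sum>y\<in>S. \<Sum>a\<in>S \<union> A. w y a)"
      by (rule sum.cong[OF refl])
    also have "\<dots> = (\<Sum>y\<in>S. \<Sum>a\<in>S. w y a) + (\<Sum>y\<in>S. \<Sum>a\<in>A. w y a)"
      using S A by (simp add: sum.union_disjoint sum.distrib)
    also have "(\<Sum>y\<in>S. \<Sum>a\<in>S. w y a) = 0"
      unfolding w_def sum_subtractf
      by (subst (2) sum.swap) simp
    also have "0 + (\<Sum>y\<in>S. \<Sum>a\<in>A. w y a) = (\<Sum>a\<in>A. \<Sum>y\<in>S. w y a)"
      by (subst sum.swap) simp
    also have "\<bar>\<dots>\<bar> \<le> (\<Sum>a\<in>A. 2 * B * int K)"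
    proof (rule order_trans[OF sum_abs sum_mono])
      fix a assume "a \<in> A"
      then have a: "finite {y\<in>Y. dist a y \<le> r}" "card {y\<in>Y. dist a y \<le> r} \<le> K"
        using K A by blast+
      have "w y a = 0" if "y \<in> S" "\<not> dist a y \<le> r" for y
      proof -
        have "b [a, y] = 0" "b [y, a] = 0"
          using that edge[of a y] edge[of y a] dist_commute[of a y] by auto
        then show ?thesis by (simp add: w_def)
      qed
      then have "(\<Sum>y\<in>S. w y a) = (\<Sum>y\<in>S \<inter> {y\<in>Y. dist a y \<le> r}. w y a)"
        using S by (intro sum.mono_neutral_right) auto
      also have "\<bar>\<dots>\<bar> \<le> of_nat (card (S \<inter> {y\<in>Y. dist a y \<le> r})) * (2 * B)"
        by (rule order_trans[OF sum_abs sum_bounded_above]) (rule w_le)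
      also have "\<dots> \<le> int K * (2 * B)"
      proof (rule mult_right_mono)
        have "card (S \<inter> {y\<in>Y. dist a y \<le> r}) \<le> card {y\<in>Y. dist a y \<le> r}"
          using a(1) by (intro card_mono) auto
        then show "of_nat (card (S \<inter> {y\<in>Y. dist a y \<le> r})) \<le> int K"
          using a(2) by linarith
      qed (use \<open>B \<ge> 0\<close> in simp)
      finally show "\<bar>\<Sum>y\<in>S. w y a\<bar> \<le> 2 * B * int K" by (simp add: mult.commute)
    qed
    finally show ?thesis
      using \<open>B \<ge> 0\<close> by (simp add: A_def mult.commute)
  qed
  then show ?thesis by (rule that)
qed

lemma qi_embedding_finite_fibre:
  assumes X: "UDBG X" and f: "qi_embedding X Y f"
  shows "finite {x\<in>X. f x = y}"
proof (cases "{x\<in>X. f x = y} = {}")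
  case False
  then obtain x0 where x0: "x0 \<in> X" "f x0 = y" by blast
  obtain C D where "C > 0" and CD: "\<And>x x'. x \<in> X \<Longrightarrow> x' \<in> X \<Longrightarrow> 1 / C * dist x x' - D \<le> dist (f x) (f x')"
    using f unfolding qi_embedding_def by blast
  have sub: "{x\<in>X. f x = y} \<subseteq> {x\<in>X. dist x0 x \<le> C * D}"
  proof (intro subsetI CollectI conjI)
    fix x assume x: "x \<in> {x\<in>X. f x = y}"
    then have "1 / C * dist x0 x - D \<le> 0" using CD[of x0 x] x0 by simp
    then show "dist x0 x \<le> C * D" using \<open>C > 0\<close> by (simp add: field_simps)
  qed auto
  obtain K where "\<And>x. x \<in> X \<Longrightarrow> finite {y\<in>X. dist x y \<le> C * D} \<and> card {y\<in>X. dist x y \<le> C * D} \<le> K"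
    using UDBG_bounded_geometry[OF X, of "C * D"] by blast
  then show ?thesis using finite_subset[OF sub] x0 by blast
next
  case True
  then show ?thesis by (simp only: finite.emptyI)
qed

lemma sum_pushforward_0:
  assumes X: "UDBG X" and f: "qi_embedding X Y f" and c: "c \<in> uf_chains X 0" and S: "finite S"
  shows "finite {x\<in>X. f x \<in> S} \<and> (\<Sum>y\<in>S. formal_extension (map f) c [y]) = (\<Sum>x | x \<in> X \<and> f x \<in> S. c [x])"
proof -
  note fin = qi_embedding_finite_fibre[OF X f]
  have "{x\<in>X. f x \<in> S} = (\<Union>y\<in>S. {x\<in>X. f x = y})" by auto
  then have finS: "finite {x\<in>X. f x \<in> S}" using S fin by simp
  have "formal_extension (map f) c [y] = (\<Sum>x | x \<in> {x\<in>X. f x \<in> S} \<and> f x = y. c [x])" if "y \<in> S" for y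
  proof -
    have "formal_extension (map f) c [y] = sum c ((\<lambda>x. [x]) ` {x\<in>X. f x = y})"
    proof (rule formal_extension_eq_sum)
      fix xs assume xs: "c xs \<noteq> 0" "map f xs = [y]"
      then have "length xs = Suc 0" "set xs \<subseteq> X" using c by (auto simp: uf_chains_def)
      then obtain x where "xs = [x]" "x \<in> X" by (auto simp: length_Suc_conv)
      then show "xs \<in> (\<lambda>x. [x]) ` {x\<in>X. f x = y}" using xs by auto
    qed (use fin[of y] in auto)
    also have "\<dots> = (\<Sum>x | x \<in> X \<and> f x = y. c [x])"
      by (simp add: sum.reindex inj_on_def)
    also have "{x. x \<in> X \<and> f x = y} = {x. x \<in> {x\<in>X. f x \<in> S} \<and> f x = y}"
      using that by auto
    finally show ?thesis .
  qed
  then have "(\<Sum>y\<in>S. formal_extension (map f) c [y]) = (\<Sum>y\<in>S. \<Sum>x | x \<in> {x\<in>X. f x \<in> S} \<and> f x = y. c [x])"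
    by (rule sum.cong[OF refl])
  also have "\<dots> = (\<Sum>x\<in>{x\<in>X. f x \<in> S}. c [x])"
    using finS S by (intro sum.group) auto
  finally show ?thesis using finS by simp
qed

section \<open>Isometry in degree zero\<close>

definition fundamental_cycle :: "'a set \<Rightarrow> 'a list \<Rightarrow> int" where
  "fundamental_cycle X xs = (if \<exists>x\<in>X. xs = [x] then 1 else 0)"

lemma fundamental_cycle_chain: "fundamental_cycle X \<in> uf_chains X 0"
  unfolding uf_chains_iff
proof
  show "\<exists>B. \<forall>xs. \<bar>fundamental_cycle X xs\<bar> \<le> B"
    by (intro exI[of _ 1]) (simp add: fundamental_cycle_def)
  show "\<exists>\<rho>. \<forall>xs. fundamental_cycle X xs \<noteq> 0 \<longrightarrow> xs \<in> tuples X 0 \<rho>"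
    by (intro exI[of _ 0]) (auto simp: fundamental_cycle_def tuples_def)
qed

lemma uf_seminorm_class_le:
  assumes X: "UDBG X" and c: "c \<in> uf_cycles X n" and d: "d \<in> uf_class X n c"
  shows "uf_seminorm (uf_class X n c) \<le> uf_norm d"
  unfolding uf_seminorm_def
proof (rule cINF_lower[OF _ d])
  have "0 \<le> uf_norm e" if "e \<in> uf_class X n c" for e
    using uf_class_subset_cycles[OF X c] that uf_norm_nonneg[of e X n] by (auto simp: uf_cycles_def)
  then show "bdd_below (uf_norm ` uf_class X n c)"
    unfolding bdd_below_def by blast
qed

text \<open>Norms of integral chains are integers, so a representative of norm less than \<open>2\<close> has norm at most \<open>1\<close>, and
an infimum of at most \<open>1\<close> provides such a representative.\<close>
lemma small_representative:
  assumes X: "UDBG X" and c: "c \<in> uf_cycles X n" and le: "uf_seminorm (uf_class X n c) \<le> 1"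
  obtains d where "d \<in> uf_class X n c" "\<And>xs. \<bar>d xs\<bar> \<le> 1"
proof -
  have "Inf (uf_norm ` uf_class X n c) < 2"
    using le by (simp add: uf_seminorm_def)
  moreover have "uf_norm ` uf_class X n c \<noteq> {}"
    using self_mem_uf_class[OF X, of c n] by (metis empty_iff image_is_empty)
  ultimately have "\<exists>t\<in>uf_norm ` uf_class X n c. t < 2"
    by (rule cInf_lessD[rotated])
  then obtain d where d: "d \<in> uf_class X n c" "uf_norm d < 2"
    by (elim bexE imageE) simp
  have "d \<in> uf_chains X n"
    using d(1) uf_class_subset_cycles[OF X c] by (auto simp: uf_cycles_def)
  then have "\<bar>d xs\<bar> \<le> 1" for xs
    using uf_norm_upper[of d X n xs] d(2) by linarith
  then show ?thesis using that d(1) by blast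
qed

lemma uf_norm_fundamental_cycle_le: "uf_norm (fundamental_cycle X) \<le> 1"
  unfolding uf_norm_def by (rule cSUP_least) (auto simp: fundamental_cycle_def)

lemma seminorm_fundamental_class_le:
  assumes "UDBG X"
  shows "uf_seminorm (uf_class X 0 (fundamental_cycle X)) \<le> 1"
  using uf_seminorm_class_le[OF assms _ self_mem_uf_class[OF assms]]
    fundamental_cycle_chain[of X] uf_norm_fundamental_cycle_le[of X]
  by (metis order_trans uf_cycles_0)

lemma sum_fundamental_cycle: "S \<subseteq> X \<Longrightarrow> (\<Sum>x\<in>S. fundamental_cycle X [x]) = int (card S)"
  by (subst sum.cong[OF refl, of _ _ "\<lambda>_. 1"]) (auto simp: fundamental_cycle_def)

lemma flow_inequality:
  assumes Y: "UDBG Y" and bdry: "(\<lambda>ys. c ys - d ys) \<in> uf_boundaries Y 0"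
  obtains D :: nat and r where "\<And>S. S \<subseteq> Y \<Longrightarrow> finite S \<Longrightarrow>
    (\<Sum>y\<in>S. d [y]) \<le> (\<Sum>y\<in>S. c [y]) + int (D * card (outer_boundary Y r S)) \<and>
    (\<Sum>y\<in>S. c [y]) \<le> (\<Sum>y\<in>S. d [y]) + int (D * card (outer_boundary Y r S))"
proof -
  obtain b where b: "b \<in> uf_chains Y (Suc 0)" "(\<lambda>ys. c ys - d ys) = uf_boundary (Suc 0) b"
    using bdry unfolding uf_boundaries_def by (elim imageE)
  obtain D r where Dr: "\<And>S. S \<subseteq> Y \<Longrightarrow> finite S \<Longrightarrow>
    \<bar>\<Sum>y\<in>S. uf_boundary (Suc 0) b [y]\<bar> \<le> int (D * card (outer_boundary Y r S))"
    using boundary_flow_bound[OF Y b(1)] by blast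
  have "(\<Sum>y\<in>S. uf_boundary (Suc 0) b [y]) = (\<Sum>y\<in>S. c [y]) - (\<Sum>y\<in>S. d [y])" for S
    unfolding b(2)[symmetric] by (simp add: sum_subtractf)
  then have "\<bar>(\<Sum>y\<in>S. c [y]) - (\<Sum>y\<in>S. d [y])\<bar> \<le> int (D * card (outer_boundary Y r S))"
    if "S \<subseteq> Y" "finite S" for S
    using Dr[OF that] by metis
  then show ?thesis
    by (intro that[of D r]) (smt (verit))
qed

text \<open>The first estimate compares \<open>f\<^sub>*[X]\<close> with a small representative of its class in \<open>Y\<close>. The second compares \<open>[Y]\<close> with
the push-forward of a small cycle \<open>c\<close> on \<open>X\<close>, obtained from a preimage of \<open>[Y]\<close>: since \<open>c \<le> 1\<close>, its
push-forward counts at most the points in the fibres of \<open>f\<close>.\<close>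
lemma isometric_iso_imp_flow:
  assumes X: "UDBG X" and Y: "UDBG Y" and f: "qi_embedding X Y f" and iso: "uf_isometric_iso X Y 0 f"
  obtains D :: nat and r where
    "\<And>S. S \<subseteq> Y \<Longrightarrow> finite S \<Longrightarrow> finite {x\<in>X. f x \<in> S}"
    "\<And>S. S \<subseteq> Y \<Longrightarrow> finite S \<Longrightarrow> card {x\<in>X. f x \<in> S} \<le> card S + D * card (outer_boundary Y r S)"
    "\<And>S. S \<subseteq> Y \<Longrightarrow> finite S \<Longrightarrow> card S \<le> card {x\<in>X. f x \<in> S} + D * card (outer_boundary Y r S)"
proof -
  have norm_eq: "uf_seminorm (uf_homology_map Y 0 f \<alpha>) = uf_seminorm \<alpha>"
    if "\<alpha> \<in> carrier (uf_homology X 0)" for \<alpha>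
    using iso that by (simp add: uf_isometric_iso_def)
  have surj: "uf_homology_map Y 0 f ` carrier (uf_homology X 0) = carrier (uf_homology Y 0)"
    using iso by (simp add: uf_isometric_iso_def iso_def bij_betw_def)
  let ?FX = "formal_extension (map f) (fundamental_cycle X)"
  have fX: "fundamental_cycle X \<in> uf_cycles X 0" and fY: "fundamental_cycle Y \<in> uf_cycles Y 0"
    by (simp_all add: uf_cycles_0 fundamental_cycle_chain)
  have "uf_seminorm (uf_class Y 0 ?FX) \<le> 1"
    using norm_eq[of "uf_class X 0 (fundamental_cycle X)"] seminorm_fundamental_class_le[OF X] fX
    by (simp add: carrier_uf_homology uf_homology_map_class[OF X Y f fX])
  then obtain d where d: "d \<in> uf_class Y 0 ?FX" "\<And>ys. \<bar>d ys\<bar> \<le> 1"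
    using small_representative[OF Y map_uf_cycles[OF X Y f fX]] by blast
  obtain D1 r1 where flow1: "\<And>S. S \<subseteq> Y \<Longrightarrow> finite S \<Longrightarrow>
      (\<Sum>y\<in>S. ?FX [y]) \<le> (\<Sum>y\<in>S. d [y]) + int (D1 * card (outer_boundary Y r1 S))"
    using flow_inequality[OF Y d(1)[unfolded mem_uf_class_iff]] by metis
  have "uf_class Y 0 (fundamental_cycle Y) \<in> carrier (uf_homology Y 0)"
    using fY by (simp add: carrier_uf_homology)
  then obtain \<alpha> where \<alpha>: "\<alpha> \<in> carrier (uf_homology X 0)"
    "uf_homology_map Y 0 f \<alpha> = uf_class Y 0 (fundamental_cycle Y)"
    using surj by (metis imageE)
  obtain e where e: "e \<in> uf_cycles X 0" "\<alpha> = uf_class X 0 e"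
    using \<alpha>(1) by (auto simp: carrier_uf_homology)
  have "uf_seminorm (uf_class X 0 e) \<le> 1"
    using norm_eq[OF \<alpha>(1)] \<alpha>(2) e(2) seminorm_fundamental_class_le[OF Y] by simp
  then obtain c where c: "c \<in> uf_class X 0 e" "\<And>xs. \<bar>c xs\<bar> \<le> 1"
    using small_representative[OF X e(1)] by blast
  have cX: "c \<in> uf_cycles X 0" using c(1) uf_class_subset_cycles[OF X e(1)] by blast
  have "uf_class Y 0 (formal_extension (map f) c) = uf_homology_map Y 0 f \<alpha>"
    unfolding e(2) uf_class_eq[OF X e(1) c(1), symmetric] by (rule uf_homology_map_class[OF X Y f cX, symmetric])
  then have bdryY: "fundamental_cycle Y \<in> uf_class Y 0 (formal_extension (map f) c)"
    using \<alpha>(2) self_mem_uf_class[OF Y] by simp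
  obtain D2 r2 where flow2: "\<And>S. S \<subseteq> Y \<Longrightarrow> finite S \<Longrightarrow>
      (\<Sum>y\<in>S. fundamental_cycle Y [y]) \<le> (\<Sum>y\<in>S. formal_extension (map f) c [y]) + int (D2 * card (outer_boundary Y r2 S))"
    using flow_inequality[OF Y bdryY[unfolded mem_uf_class_iff]] by metis
  note sumX = sum_pushforward_0[OF X f fundamental_cycle_chain]
  note sumc = sum_pushforward_0[OF X f cX[unfolded uf_cycles_0]]
  let ?D = "max D1 D2" and ?r = "max r1 r2"
  have enlarge: "D1 * card (outer_boundary Y r1 S) \<le> ?D * card (outer_boundary Y ?r S)"
    "D2 * card (outer_boundary Y r2 S) \<le> ?D * card (outer_boundary Y ?r S)"
    if "S \<subseteq> Y" "finite S" for S
    by (intro mult_le_mono card_mono finite_outer_boundary[OF Y that(2,1)] outer_boundary_mono; simp)+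
  show ?thesis
  proof (rule that)
    fix S assume S: "S \<subseteq> Y" "finite S"
    show "finite {x\<in>X. f x \<in> S}" using sumX[OF S(2)] by blast
    have "int (card {x\<in>X. f x \<in> S}) = (\<Sum>y\<in>S. ?FX [y])"
      using sumX[OF S(2)] sum_fundamental_cycle[of "{x\<in>X. f x \<in> S}" X] by simp
    also have "\<dots> \<le> (\<Sum>y\<in>S. d [y]) + int (D1 * card (outer_boundary Y r1 S))"
      by (rule flow1[OF S])
    also have "(\<Sum>y\<in>S. d [y]) \<le> of_nat (card S) * 1"
      using d(2) by (intro sum_bounded_above) (simp add: abs_le_iff)
    finally show "card {x\<in>X. f x \<in> S} \<le> card S + ?D * card (outer_boundary Y ?r S)"
      using enlarge(1)[OF S] by linarith
    have "int (card S) = (\<Sum>y\<in>S. fundamental_cycle Y [y])"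
      using sum_fundamental_cycle[OF S(1)] by simp
    also have "\<dots> \<le> (\<Sum>y\<in>S. formal_extension (map f) c [y]) + int (D2 * card (outer_boundary Y r2 S))"
      by (rule flow2[OF S])
    also have "(\<Sum>y\<in>S. formal_extension (map f) c [y]) \<le> of_nat (card {x\<in>X. f x \<in> S}) * 1"
      unfolding conjunct2[OF sumc[OF S(2)]] using c(2) by (intro sum_bounded_above) (simp add: abs_le_iff)
    finally show "card S \<le> card {x\<in>X. f x \<in> S} + ?D * card (outer_boundary Y ?r S)"
      using enlarge(2)[OF S] by linarith
  qed
qed

section \<open>From flow estimates to a bilipschitz bijection\<close>

lemma neighbours_power_dist:
  assumes "\<And>z w. w \<in> N z \<Longrightarrow> dist z w \<le> s" and "w \<in> (neighbours N ^^ k) {z}"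
  shows "dist z w \<le> real k * s"
  using assms(2)
proof (induction k arbitrary: w)
  case (Suc k)
  then obtain v where v: "v \<in> (neighbours N ^^ k) {z}" "w \<in> N v"
    by (auto simp: neighbours_def[of N "(neighbours N ^^ k) {z}"])
  then show ?case
    using Suc.IH[OF v(1)] assms(1)[OF v(2)] dist_triangle[of z w v] by (simp add: algebra_simps)
qed simp

text \<open>Both \<open>f\<close> and a bounded retraction \<open>\<pi>\<close> of \<open>Y\<close> onto the image \<open>Z\<close> of \<open>f\<close> are surjections onto \<open>Z\<close>, which
puts \<open>X\<close> and \<open>Y\<close> into symmetric roles. The estimates on \<open>Y\<close>, applied to the full preimage of a
set under \<open>\<pi>\<close>, become estimates on \<open>Z\<close> in both directions.\<close>
lemma flow_imp_close_bijection:
  fixes X :: "'a set" and Y :: "'b::metric_space set"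
  assumes Y: "UDBG Y" and fY: "f \<in> X \<rightarrow> Y" and dense: "\<And>y. y \<in> Y \<Longrightarrow> \<exists>x\<in>X. dist (f x) y \<le> M"
    and fin: "\<And>S. S \<subseteq> Y \<Longrightarrow> finite S \<Longrightarrow> finite {x\<in>X. f x \<in> S}"
    and flow1: "\<And>S. S \<subseteq> Y \<Longrightarrow> finite S \<Longrightarrow> card {x\<in>X. f x \<in> S} \<le> card S + D * card (outer_boundary Y r S)"
    and flow2: "\<And>S. S \<subseteq> Y \<Longrightarrow> finite S \<Longrightarrow> card S \<le> card {x\<in>X. f x \<in> S} + D * card (outer_boundary Y r S)"
  obtains h where "bij_betw h X Y" "uniformly_close X f h"
proof -
  define Z where "Z = f ` X"
  have ZY: "Z \<subseteq> Y" using fY by (auto simp: Z_def)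
  have "\<exists>z\<in>Z. dist z y \<le> \<bar>M\<bar> \<and> (y \<in> Z \<longrightarrow> z = y)" if y: "y \<in> Y" for y
  proof (cases "y \<in> Z")
    case False
    then show ?thesis using dense[OF y] by (force simp: Z_def)
  qed auto
  then obtain \<pi> where \<pi>: "\<And>y. y \<in> Y \<Longrightarrow> \<pi> y \<in> Z \<and> dist (\<pi> y) y \<le> \<bar>M\<bar> \<and> (y \<in> Z \<longrightarrow> \<pi> y = y)"
    by metis
  \<comment> \<open>\<open>\<pi>\<close> moves points by at most \<open>\<bar>M\<bar>\<close>, so it can stretch edges of length \<open>r\<close> to this length.\<close>
  define s where "s = \<bar>r\<bar> + 2 * \<bar>M\<bar>"
  define N where "N z = {z'\<in>Z. dist z z' \<le> s}" for z
  obtain K where K: "\<And>x. x \<in> Y \<Longrightarrow> finite {y\<in>Y. dist x y \<le> \<bar>M\<bar>} \<and> card {y\<in>Y. dist x y \<le> \<bar>M\<bar>} \<le> K"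
    using UDBG_bounded_geometry[OF Y, of "\<bar>M\<bar>"] by blast
  have fibre: "finite {y\<in>Y. \<pi> y = z} \<and> card {y\<in>Y. \<pi> y = z} \<le> K" if "z \<in> Z" for z
  proof -
    have z: "z \<in> Y" using that ZY by blast
    have sub: "{y\<in>Y. \<pi> y = z} \<subseteq> {y\<in>Y. dist z y \<le> \<bar>M\<bar>}" using \<pi> by auto
    show ?thesis
      using finite_subset[OF sub] card_mono[OF _ sub] K[OF z] by (meson order_trans)
  qed
  have N: "finite (N z) \<and> N z \<subseteq> Z \<and> z \<in> N z" if "z \<in> Z" for z
  proof -
    obtain L where "\<And>x. x \<in> Y \<Longrightarrow> finite {y\<in>Y. dist x y \<le> s} \<and> card {y\<in>Y. dist x y \<le> s} \<le> L"
      using UDBG_bounded_geometry[OF Y, of s] by blast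
    then have "finite {y\<in>Y. dist z y \<le> s}" using that ZY by blast
    moreover have "N z \<subseteq> {y\<in>Y. dist z y \<le> s}" using ZY by (auto simp: N_def)
    ultimately have "finite (N z)" by (rule finite_subset[rotated])
    then show ?thesis using that by (simp add: N_def s_def)
  qed
  have transfer: "card {x\<in>X. f x \<in> S} \<le> card {y\<in>Y. \<pi> y \<in> S} + D * K * card (neighbours N S - S) \<and>
      card {y\<in>Y. \<pi> y \<in> S} \<le> card {x\<in>X. f x \<in> S} + D * K * card (neighbours N S - S)"
    if S: "S \<subseteq> Z" "finite S" for S
  proof -
    define T where "T = {y\<in>Y. \<pi> y \<in> S}"
    have "T = (\<Union>z\<in>S. {y\<in>Y. \<pi> y = z})" by (auto simp: T_def)
    then have T: "T \<subseteq> Y" "finite T" using S fibre by (auto simp: T_def)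
    have XT: "{x\<in>X. f x \<in> T} = {x\<in>X. f x \<in> S}"
      using \<pi> fY by (auto simp: T_def Z_def Pi_iff)
    let ?A = "outer_boundary Y r T" and ?B = "neighbours N S - S"
    have "finite ?A \<and> card ?A \<le> K * card ?B"
    proof (rule card_le_mult_card_image[where \<pi> = \<pi>])
      show "finite ?B" using S N by (auto simp: neighbours_def)
      show "\<pi> ` ?A \<subseteq> ?B"
      proof (rule image_subsetI)
        fix a assume "a \<in> ?A"
        then obtain y where a: "a \<in> Y" "a \<notin> T" and y: "y \<in> Y" "\<pi> y \<in> S" "dist y a \<le> r"
          by (auto simp: outer_boundary_def T_def)
        have "dist (\<pi> a) a \<le> \<bar>M\<bar>" "dist (\<pi> y) y \<le> \<bar>M\<bar>"
          using \<pi>[OF a(1)] \<pi>[OF y(1)] by blast+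
        then have "dist (\<pi> y) (\<pi> a) \<le> s"
          using y(3) dist_triangle[of "\<pi> y" "\<pi> a" y] dist_triangle[of y "\<pi> a" a] dist_commute[of "\<pi> a" a]
          unfolding s_def by linarith
        then show "\<pi> a \<in> ?B"
          using a y \<pi>[OF a(1)] by (auto simp: neighbours_def N_def T_def)
      qed
      fix z assume "z \<in> ?B"
      then have z: "z \<in> Z" using N S by (auto simp: neighbours_def)
      have sub: "{y\<in>?A. \<pi> y = z} \<subseteq> {y\<in>Y. \<pi> y = z}" by (auto simp: outer_boundary_def)
      show "finite {y\<in>?A. \<pi> y = z} \<and> card {y\<in>?A. \<pi> y = z} \<le> K"
        using finite_subset[OF sub] card_mono[OF _ sub] fibre[OF z] by (meson order_trans)
    qed
    then have "D * card ?A \<le> D * K * card ?B" by (simp add: mult.assoc)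
    then show ?thesis
      using flow1[OF T] flow2[OF T] unfolding XT unfolding T_def by linarith
  qed
  have f_fibre: "finite {x\<in>X. f x = z}" if "z \<in> Z" for z
    using fin[of "{z}"] that ZY by auto
  have "\<pi> ` Y = Z" using \<pi> ZY by force
  have "\<exists>\<phi>. inj_on \<phi> X \<and> \<phi> ` X \<subseteq> Y \<and> (\<forall>x\<in>X. \<pi> (\<phi> x) \<in> (neighbours N ^^ Suc (D * K)) {f x})"
    using transfer by (intro expansion_matching[OF N Z_def[symmetric] f_fibre \<open>\<pi> ` Y = Z\<close>] conjunct1[OF fibre]) blast+
  then obtain \<phi> where \<phi>: "inj_on \<phi> X" "\<phi> ` X \<subseteq> Y"
    "\<And>x. x \<in> X \<Longrightarrow> \<pi> (\<phi> x) \<in> (neighbours N ^^ Suc (D * K)) {f x}" by blast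
  have "\<exists>\<psi>. inj_on \<psi> Y \<and> \<psi> ` Y \<subseteq> X \<and> (\<forall>y\<in>Y. f (\<psi> y) \<in> (neighbours N ^^ Suc (D * K)) {\<pi> y})"
    using transfer by (intro expansion_matching[OF N \<open>\<pi> ` Y = Z\<close> conjunct1[OF fibre] Z_def[symmetric] f_fibre]) blast+
  then obtain \<psi> where \<psi>: "inj_on \<psi> Y" "\<psi> ` Y \<subseteq> X"
    "\<And>y. y \<in> Y \<Longrightarrow> f (\<psi> y) \<in> (neighbours N ^^ Suc (D * K)) {\<pi> y}" by blast
  define L where "L = real (Suc (D * K)) * s"
  have N_dist: "dist z w \<le> s" if "w \<in> N z" for z w using that by (simp add: N_def)
  have "\<exists>h. bij_betw h X Y \<and> (\<forall>x\<in>X. dist (f x) (\<pi> (h x)) \<le> L)"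
  proof (rule Schroeder_Bernstein_relation[OF \<phi>(1,2) _ \<psi>(1,2)])
    show "dist (f x) (\<pi> (\<phi> x)) \<le> L" if "x \<in> X" for x
      unfolding L_def by (rule neighbours_power_dist[OF N_dist \<phi>(3)[OF that]])
    show "dist (f (\<psi> y)) (\<pi> y) \<le> L" if "y \<in> Y" for y
      unfolding L_def dist_commute[of "f (\<psi> y)"] by (rule neighbours_power_dist[OF N_dist \<psi>(3)[OF that]])
  qed
  then obtain h where h: "bij_betw h X Y" "\<And>x. x \<in> X \<Longrightarrow> dist (f x) (\<pi> (h x)) \<le> L" by blast
  have "dist (f x) (h x) \<le> L + \<bar>M\<bar>" if "x \<in> X" for x
  proof -
    have "h x \<in> Y" using h(1) that by (auto simp: bij_betw_def)
    then show ?thesis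
      using h(2)[OF that] \<pi>[of "h x"] dist_triangle[of "f x" "h x" "\<pi> (h x)"] by linarith
  qed
  then have "uniformly_close X f h"
    unfolding uniformly_close_def bdd_above_def by blast
  with h(1) show ?thesis by (rule that)
qed

text \<open>Distinct points have distance at least some \<open>\<epsilon>\<close>, so an additive error \<open>E\<close> is at most \<open>E / \<epsilon>\<close> times their
distance. Injectivity makes this applicable to the images as well.\<close>
lemma bijection_close_to_qi_embedding_is_bilipschitz:
  assumes X: "UDBG X" and Y: "UDBG Y" and f: "qi_embedding X Y f"
    and h: "bij_betw h X Y" and close: "uniformly_close X f h"
  shows "bilipschitz_equivalence X Y h"
proof -
  obtain C D where "C > 0" "D > 0" and qi: "\<And>x x'. x \<in> X \<Longrightarrow> x' \<in> X \<Longrightarrow>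
      1 / C * dist x x' - D \<le> dist (f x) (f x') \<and> dist (f x) (f x') \<le> C * dist x x' + D"
    using f unfolding qi_embedding_def by blast
  obtain M where M: "\<And>x. x \<in> X \<Longrightarrow> dist (f x) (h x) \<le> M"
    using close unfolding uniformly_close_def bdd_above_def by blast
  obtain \<epsilon>X where "\<epsilon>X > 0" and \<epsilon>X: "\<And>x y. x \<in> X \<Longrightarrow> y \<in> X \<Longrightarrow> x \<noteq> y \<Longrightarrow> \<epsilon>X \<le> dist x y"
    using X unfolding UDBG_def by (metis not_le)
  obtain \<epsilon>Y where "\<epsilon>Y > 0" and \<epsilon>Y: "\<And>x y. x \<in> Y \<Longrightarrow> y \<in> Y \<Longrightarrow> x \<noteq> y \<Longrightarrow> \<epsilon>Y \<le> dist x y"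
    using Y unfolding UDBG_def by (metis not_le)
  define E where "E = D + 2 * \<bar>M\<bar>"
  have "E > 0" using \<open>D > 0\<close> by (simp add: E_def)
  define L where "L = max (C + E / \<epsilon>X) (C * (1 + E / \<epsilon>Y))"
  have "L > 0" unfolding L_def using \<open>C > 0\<close> \<open>E > 0\<close> \<open>\<epsilon>X > 0\<close> by (simp add: add_pos_pos less_max_iff_disj)
  have hY: "h x \<in> Y" if "x \<in> X" for x using h that by (auto simp: bij_betw_def)
  have bounds: "dist (h x) (h x') \<le> L * dist x x' \<and> dist x x' \<le> L * dist (h x) (h x')"
    if x: "x \<in> X" "x' \<in> X" for x x'
  proof (cases "x = x'")
    case False
    then have ne: "h x \<noteq> h x'" using h x by (auto simp: bij_betw_def inj_on_def)
    have upper: "dist (h x) (h x') \<le> C * dist x x' + E"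
      using conjunct2[OF qi[OF x]] M[OF x(1)] M[OF x(2)] dist_commute[of "h x" "f x"]
        dist_triangle[of "h x" "h x'" "f x"] dist_triangle[of "f x" "h x'" "f x'"]
      unfolding E_def by linarith
    have "dist (f x) (f x') \<le> dist (h x) (h x') + 2 * \<bar>M\<bar>"
      using M[OF x(1)] M[OF x(2)] dist_commute[of "h x'" "f x'"]
        dist_triangle[of "f x" "f x'" "h x"] dist_triangle[of "h x" "f x'" "h x'"]
      by linarith
    then have "1 / C * dist x x' \<le> dist (h x) (h x') + E"
      using conjunct1[OF qi[OF x]] unfolding E_def by linarith
    then have lower: "dist x x' \<le> C * (dist (h x) (h x') + E)"
      using \<open>C > 0\<close> by (simp add: field_simps)
    have "E = E / \<epsilon>X * \<epsilon>X" using \<open>\<epsilon>X > 0\<close> by simp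
    also have "\<dots> \<le> E / \<epsilon>X * dist x x'"
      using \<epsilon>X[OF x False] \<open>E > 0\<close> \<open>\<epsilon>X > 0\<close> by (intro mult_left_mono) auto
    finally have "dist (h x) (h x') \<le> (C + E / \<epsilon>X) * dist x x'"
      using upper by (simp add: distrib_right)
    also have "\<dots> \<le> L * dist x x'" by (intro mult_right_mono) (simp_all add: L_def)
    finally have 1: "dist (h x) (h x') \<le> L * dist x x'" .
    have "E = E / \<epsilon>Y * \<epsilon>Y" using \<open>\<epsilon>Y > 0\<close> by simp
    also have "\<dots> \<le> E / \<epsilon>Y * dist (h x) (h x')"
      using \<epsilon>Y[OF hY[OF x(1)] hY[OF x(2)] ne] \<open>E > 0\<close> \<open>\<epsilon>Y > 0\<close> by (intro mult_left_mono) auto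
    finally have "dist (h x) (h x') + E \<le> (1 + E / \<epsilon>Y) * dist (h x) (h x')"
      by (simp add: distrib_right)
    then have "C * (dist (h x) (h x') + E) \<le> C * ((1 + E / \<epsilon>Y) * dist (h x) (h x'))"
      using \<open>C > 0\<close> by (intro mult_left_mono) auto
    also have "\<dots> \<le> L * dist (h x) (h x')"
      unfolding mult.assoc[symmetric] by (intro mult_right_mono) (simp_all add: L_def)
    finally show ?thesis using 1 lower by linarith
  qed simp
  have inv_dist: "1 / L * d \<le> d' \<longleftrightarrow> d \<le> L * d'" for d d' :: real
    using \<open>L > 0\<close> by (simp add: field_simps)
  have "bilipschitz_embedding X Y h"
    unfolding bilipschitz_embedding_def
  proof (intro conjI exI[of _ L] \<open>L > 0\<close> ballI)
    show "h \<in> X \<rightarrow> Y" using hY by blast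
    fix x x' assume "x \<in> X" "x' \<in> X"
    then show "1 / L * dist x x' \<le> dist (h x) (h x')" "dist (h x) (h x') \<le> L * dist x x'"
      unfolding inv_dist using bounds by blast+
  qed
  moreover have "bilipschitz_embedding Y X (inv_into X h)"
    unfolding bilipschitz_embedding_def
  proof (intro conjI exI[of _ L] \<open>L > 0\<close> ballI)
    have inv: "inv_into X h y \<in> X \<and> h (inv_into X h y) = y" if "y \<in> Y" for y
      using h that by (auto simp: bij_betw_def inv_into_into f_inv_into_f)
    then show "inv_into X h \<in> Y \<rightarrow> X" by blast
    fix y y' assume y: "y \<in> Y" "y' \<in> Y"
    show "1 / L * dist y y' \<le> dist (inv_into X h y) (inv_into X h y')"
      and "dist (inv_into X h y) (inv_into X h y') \<le> L * dist y y'"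
      unfolding inv_dist
      using bounds[of "inv_into X h y" "inv_into X h y'"] inv[OF y(1)] inv[OF y(2)] by auto
  qed
  moreover have "\<forall>x\<in>X. inv_into X h (h x) = x" "\<forall>y\<in>Y. h (inv_into X h y) = y"
    using h by (auto simp: bij_betw_def inv_into_f_f f_inv_into_f)
  ultimately show ?thesis
    unfolding bilipschitz_equivalence_def by blast
qed

section \<open>Equivalence of the three conditions\<close>

theorem theorem1p1:
  fixes X :: "'a::metric_space set" and Y :: "'b::metric_space set" and f :: "'a \<Rightarrow> 'b"
  assumes "UDBG X" and "UDBG Y" and "quasi_isometry X Y f"
  shows "((\<exists>f'. bilipschitz_equivalence X Y f' \<and> uniformly_close X f f')
            \<longleftrightarrow> (\<forall>k. uf_isometric_iso X Y k f)) \<and>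
         ((\<forall>k. uf_isometric_iso X Y k f) \<longleftrightarrow> uf_isometric_iso X Y 0 f)"
proof -
  have f: "qi_embedding X Y f"
    using assms(3) by (simp add: quasi_isometry_def)
  obtain g where g: "g \<in> Y \<rightarrow> X" "uniformly_close Y (f \<circ> g) id"
    using assms(3) by (auto simp: quasi_isometry_def qi_embedding_def)
  obtain M where M: "\<And>y. y \<in> Y \<Longrightarrow> dist (f (g y)) y \<le> M"
    using g(2) unfolding uniformly_close_def bdd_above_def by auto
  have fY: "f \<in> X \<rightarrow> Y"
    using f by (simp add: qi_embedding_def)
  have dense: "\<exists>x\<in>X. dist (f x) y \<le> M" if "y \<in> Y" for y
    using g(1) M that by blast
  have "\<exists>f'. bilipschitz_equivalence X Y f' \<and> uniformly_close X f f'" if iso: "uf_isometric_iso X Y 0 f"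
  proof -
    obtain D r where flow:
      "\<And>S. S \<subseteq> Y \<Longrightarrow> finite S \<Longrightarrow> finite {x\<in>X. f x \<in> S}"
      "\<And>S. S \<subseteq> Y \<Longrightarrow> finite S \<Longrightarrow> card {x\<in>X. f x \<in> S} \<le> card S + D * card (outer_boundary Y r S)"
      "\<And>S. S \<subseteq> Y \<Longrightarrow> finite S \<Longrightarrow> card S \<le> card {x\<in>X. f x \<in> S} + D * card (outer_boundary Y r S)"
      by (rule isometric_iso_imp_flow[OF assms(1,2) f iso]) blast
    obtain h where h: "bij_betw h X Y" "uniformly_close X f h"
      by (rule flow_imp_close_bijection[OF assms(2) fY dense flow]) blast+
    then show ?thesis
      using bijection_close_to_qi_embedding_is_bilipschitz[OF assms(1,2) f] by blast
  qed
  moreover have "uf_isometric_iso X Y k f"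
    if "bilipschitz_equivalence X Y f'" "uniformly_close X f f'" for f' k
    by (rule close_to_bilipschitz_imp_isometric_iso[OF assms(1,2) f that])
  ultimately show ?thesis by blast
qed

end
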